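(* Assume that $\delta^\star:=\min_{1\le i,j\le K}Q_\star(i,j)>0$ and that the initial distribution $\pi^\star$ is the stationary distribution of $Q_\star$. Let $C_\star:=4(1-\delta^\star)/\delta^\star$ and $\widehat\delta:=\min_{x,x'}\widehat Q(x,x')$. Then for all $n\ge1$ and any permutation $\tau_p\in\mathcal S_K$, $$\sup_{1\le k\le n}\mathbb E\big[\|\phi^\star_k(\cdot,Y_{p+1:p+k})-\widehat\phi^{\,\tau_p}_k(\cdot,Y_{p+1:p+k})\|_{\mathrm{tv}}\big]\le\frac{C_\star}{(\delta^\star)^2}\Big\{\mathbb E[\|\pi^\star-\mathbb P_{\tau_p}\widehat\pi\|_2]+\mathbb E[\|Q_\star-\mathbb P_{\tau_p}\widehat Q\,\mathbb P_{\tau_p}^\top\|_F]+\sum_{x\in\mathcal X}\mathbb E[\|f^\star_x-\widehat f_{\tau_p(x)}\|_1]\Big\}$$ and $$\sup_{1\le k\le n}\mathbb E\big[\|\phi^\star_{k|n}(\cdot,Y_{p+1:p+n})-\widehat\phi^{\,\tau_p}_{k|n}(\cdot,Y_{p+1:p+n})\|_{\mathrm{tv}}\big]\le\frac{C_\star}{(\delta^\star)^2}\Big\{\mathbb E[\|\pi^\star-\mathbb P_{\tau_p}\widehat\pi\|_2]+\mathbb E\big[\|Q_\star-\mathbb P_{\tau_p}\widehat Q\,\mathbb P_{\tau_p}^\top\|_F/\widehat\delta\big]+\sum_{x\in\mathcal X}\mathbb E\big[\|f^\star_x-\widehat f_{\tau_p(x)}\|_1/\widehat\delta\big]\Big\}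.$$
   Context: Setting. $K\ge2$ is an integer, $\mathcal X=\{1,\dots,K\}$, $\mathcal Y\subset\mathbb R^D$, $\mathcal L^D$ is Lebesgue measure on $\mathcal Y$. $(X_j,Y_j)_{j\ge1}$ is a hidden Markov model: $(X_j)$ is a Markov chain on $\mathcal X$ with initial distribution $\pi^\star$ and transition matrix $Q_\star$; conditionally on $(X_j)_{j\ge1}$ the $\mathcal Y$-valued variables $Y_j$ are independent, the conditional law of $Y_\ell$ depends only on $X_\ell$, and given $X_\ell=x$ it has density $f^\star_x$ with respect to $\mathcal L^D$. $Y_{a:b}=(Y_a,\dots,Y_b)$. Estimators: $\widehat\pi,\widehat Q,(\widehat f_x)_{x\in\mathcal X}$ (a probability vector, a transition matrix and nonnegative functions on $\mathcal Y$) are measurable functions of the first $p$ observations $Y_{1:p}$. $\mathcal S_K$ is the set of permutations of $\{1,\dots,K\}$ and $\mathbb P_\tau$ is the permutation matrix of $\tau$, with $(\mathbb P_\tau v)(x)=v(\tau(x))$. Filtering distributions: $$\phi^\star_1(x,y_1)=\frac{\pi^\star(x)f^\star_x(y_1)}{\sum_{x'}\pi^\star(x')f^\star_{x'}(y_1)},\qquad \phi^\star_k(x,y_{1:k})=\frac{\sum_{x'}Q_\star(x',x)f^\star_x(y_k)\phi^\star_{k-1}(x',y_{1:k-1})}{\sum_{x',x''}Q_\star(x',x'')f^\star_{x''}(y_k)\phi^\star_{k-1}(x',y_{1:k-1})}.$$ Marginal smoothing distributions: $\phi^\star_{n|n}=\phi^\star_n$ and, for $k<n$, $$\phi^\star_{k|n}(x,y_{1:n})=\sum_{x'}\frac{Q_\star(x,x')\phi^\star_k(x,y_{1:k})}{\sum_{z}Q_\star(z,x')\phi^\star_k(z,y_{1:k})}\,\phi^\star_{k+1|n}(x',y_{1:n}).$$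 $\widehat\phi^{\,\tau_p}_k$ and $\widehat\phi^{\,\tau_p}_{k|n}$ are given by the same recursions with $\pi^\star$, $Q_\star$, $(f^\star_x)_x$ replaced by $\mathbb P_{\tau_p}\widehat\pi$, $\mathbb P_{\tau_p}\widehat Q\,\mathbb P_{\tau_p}^\top$, $(\widehat f_{\tau_p(x)})_x$; it is understood that the denominators are positive. Quotients by $\widehat\delta$ are read as $+\infty$ where $\widehat\delta=0$. $\|\mu-\nu\|_{\mathrm{tv}}=\sum_{x\in\mathcal X}|\mu(x)-\nu(x)|$; $\|\cdot\|_2$ is the Euclidean norm, $\|\cdot\|_F$ the Frobenius norm, and $\|\cdot\|_1$ for functions the $\mathrm L^1(\mathcal Y,\mathcal L^D)$ norm. *)

theory Defs
  imports "HOL-Probability.Probability" "HOL-Combinatorics.Combinatorics"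
begin

text \<open>
  The state space is a finite type \<open>'k\<close> with \<open>K = CARD('k)\<close>; vectors and matrices indexed by the
  states are \<open>real^'k\<close> and \<open>real^'k^'k\<close>, so \<^term>\<open>norm\<close> is the Euclidean norm on the former and the
  Frobenius norm on the latter.  Processes are indexed from 1; values at index 0 are never used.
\<close>

definition prob_vector :: "real^'k::finite \<Rightarrow> bool" where
  "prob_vector v \<longleftrightarrow> (\<forall>x. 0 \<le> v $ x) \<and> (\<Sum>x\<in>UNIV. v $ x) = 1"

definition transition_matrix :: "real^'k^'k::finite \<Rightarrow> bool" where
  "transition_matrix Q \<longleftrightarrow> (\<forall>x. prob_vector (Q $ x))"

definition min_entry :: "real^'k^'k::finite \<Rightarrow> real" where
  "min_entry Q = Min (range (\<lambda>(i, j). Q $ i $ j))"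

definition perm_matrix :: "('k \<Rightarrow> 'k) \<Rightarrow> real^'k^'k::finite" where
  "perm_matrix \<tau> = (\<chi> x z. if z = \<tau> x then 1 else 0)"

lemma perm_matrix_mult_vec: "(perm_matrix \<tau> *v v) $ x = v $ \<tau> x"
  by (simp add: perm_matrix_def matrix_vector_mult_def if_distrib if_distribR cong: if_cong)

text \<open>Lebesgue measure on the observation space; its measurable sets are the Borel subsets.\<close>

definition leb :: "(real^'d::finite) set \<Rightarrow> (real^'d) measure" where
  "leb \<Y> = restrict_space lborel \<Y>"

definition prob_density_on :: "(real^'d::finite) set \<Rightarrow> (real^'d \<Rightarrow> real) \<Rightarrow> bool" where
  "prob_density_on \<Y> g \<longleftrightarrow>
     g \<in> borel_measurable (leb \<Y>) \<and> (\<forall>y\<in>\<Y>. 0 \<le> g y) \<and> (\<integral>\<^sup>+y. ennreal (g y) \<partial>leb \<Y>) = 1"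

definition L1_norm_on :: "(real^'d::finite) set \<Rightarrow> (real^'d \<Rightarrow> real) \<Rightarrow> ennreal" where
  "L1_norm_on \<Y> g = (\<integral>\<^sup>+y. ennreal \<bar>g y\<bar> \<partial>leb \<Y>)"

definition markov_chain ::
  "'w measure \<Rightarrow> real^'k \<Rightarrow> real^'k^'k::finite \<Rightarrow> (nat \<Rightarrow> 'w \<Rightarrow> 'k) \<Rightarrow> bool" where
  "markov_chain M \<pi> Q X \<longleftrightarrow>
     (\<forall>j\<ge>1. X j \<in> measurable M (count_space UNIV)) \<and>
     (\<forall>x. \<P>(\<omega> in M. X 1 \<omega> = x) = \<pi> $ x) \<and>
     (\<forall>n\<ge>1. \<forall>x :: nat \<Rightarrow> 'k. \<P>(\<omega> in M. \<forall>j\<in>{1..n}. X j \<omega> = x j) > 0 \<longrightarrow>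
        \<P>(\<omega> in M. X (Suc n) \<omega> = x (Suc n) \<bar> \<forall>j\<in>{1..n}. X j \<omega> = x j) = Q $ x n $ x (Suc n))"

text \<open>The sigma-algebra generated by the whole chain \<open>(X j)\<close>, \<open>j \<ge> 1\<close>.\<close>

definition chain_algebra :: "'w measure \<Rightarrow> (nat \<Rightarrow> 'w \<Rightarrow> 'k::finite) \<Rightarrow> 'w measure" where
  "chain_algebra M X =
     vimage_algebra (space M) (\<lambda>\<omega>. \<lambda>j\<in>{1..}. X j \<omega>) (PiM {1..} (\<lambda>_. count_space UNIV))"

text \<open>Conditionally on the chain, the \<open>Y j\<close> are independent, and the conditional law of \<open>Y j\<close> is the
  one with density \<open>f (X j)\<close>.\<close>

definition hidden_markov_model ::
  "'w measure \<Rightarrow> (real^'d::finite) set \<Rightarrow> real^'k \<Rightarrow> real^'k^'k::finite \<Rightarrow> ('k \<Rightarrow> real^'d \<Rightarrow> real) \<Rightarrow>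
     (nat \<Rightarrow> 'w \<Rightarrow> 'k) \<Rightarrow> (nat \<Rightarrow> 'w \<Rightarrow> real^'d) \<Rightarrow> bool" where
  "hidden_markov_model M \<Y> \<pi> Q f X Y \<longleftrightarrow>
     prob_space M \<and> \<Y> \<in> sets borel \<and>
     prob_vector \<pi> \<and> transition_matrix Q \<and> (\<forall>x. prob_density_on \<Y> (f x)) \<and>
     markov_chain M \<pi> Q X \<and>
     (\<forall>j\<ge>1. Y j \<in> measurable M (leb \<Y>)) \<and>
     (\<forall>J A. finite J \<longrightarrow> J \<subseteq> {1..} \<longrightarrow> (\<forall>j\<in>J. A j \<in> sets (leb \<Y>)) \<longrightarrow>
        (AE \<omega> in M. real_cond_exp M (chain_algebra M X)
              (indicator {\<omega> \<in> space M. \<forall>j\<in>J. Y j \<omega> \<in> A j}) \<omega> =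
           (\<Prod>j\<in>J. real_cond_exp M (chain_algebra M X)
              (indicator {\<omega> \<in> space M. Y j \<omega> \<in> A j}) \<omega>))) \<and>
     (\<forall>j\<ge>1. \<forall>A\<in>sets (leb \<Y>).
        (AE \<omega> in M. real_cond_exp M (chain_algebra M X)
              (indicator {\<omega> \<in> space M. Y j \<omega> \<in> A}) \<omega> =
           measure (density (leb \<Y>) (\<lambda>y. ennreal (f (X j \<omega>) y))) A))"

text \<open>Estimators are functions of \<open>u = (Y 1, \<dots>, Y p)\<close>, an element of the product space over
  \<open>{1..p}\<close>.  Measurability of the function-valued estimators means joint measurability in \<open>(u, y)\<close>.\<close>

definition estimators ::
  "(real^'d::finite) set \<Rightarrow> nat \<Rightarrow> ((nat \<Rightarrow> real^'d) \<Rightarrow> real^'k::finite) \<Rightarrow>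
     ((nat \<Rightarrow> real^'d) \<Rightarrow> real^'k^'k) \<Rightarrow> ((nat \<Rightarrow> real^'d) \<Rightarrow> 'k \<Rightarrow> real^'d \<Rightarrow> real) \<Rightarrow> bool" where
  "estimators \<Y> p \<pi>h Qh fh \<longleftrightarrow>
     \<pi>h \<in> borel_measurable (PiM {1..p} (\<lambda>_. leb \<Y>)) \<and>
     Qh \<in> borel_measurable (PiM {1..p} (\<lambda>_. leb \<Y>)) \<and>
     (\<forall>x. (\<lambda>(u, y). fh u x y) \<in> borel_measurable (PiM {1..p} (\<lambda>_. leb \<Y>) \<Otimes>\<^sub>M leb \<Y>)) \<and>
     (\<forall>u\<in>{1..p} \<rightarrow>\<^sub>E \<Y>.
        prob_vector (\<pi>h u) \<and> transition_matrix (Qh u) \<and> (\<forall>x. \<forall>y\<in>\<Y>. 0 \<le> fh u x y))"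

text \<open>\<open>filtering \<pi> Q f k y x\<close> is \<open>\<phi>\<^sub>k(x, y\<^sub>1\<^sub>:\<^sub>k)\<close>; only \<open>y 1, \<dots>, y k\<close> are used, and the value for
  \<open>k = 0\<close> is a dummy.\<close>

fun filtering ::
  "real^'k \<Rightarrow> real^'k^'k::finite \<Rightarrow> ('k \<Rightarrow> 'y \<Rightarrow> real) \<Rightarrow> nat \<Rightarrow> (nat \<Rightarrow> 'y) \<Rightarrow> 'k \<Rightarrow> real" where
  "filtering \<pi> Q f 0 y x = 0"
| "filtering \<pi> Q f (Suc 0) y x =
     \<pi> $ x * f x (y 1) / (\<Sum>x'\<in>UNIV. \<pi> $ x' * f x' (y 1))"
| "filtering \<pi> Q f (Suc (Suc k)) y x =
     (\<Sum>x'\<in>UNIV. Q $ x' $ x * f x (y (Suc (Suc k))) * filtering \<pi> Q f (Suc k) y x') /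
     (\<Sum>x'\<in>UNIV. \<Sum>x''\<in>UNIV.
        Q $ x' $ x'' * f x'' (y (Suc (Suc k))) * filtering \<pi> Q f (Suc k) y x')"

definition filtering_denom ::
  "real^'k \<Rightarrow> real^'k^'k::finite \<Rightarrow> ('k \<Rightarrow> 'y \<Rightarrow> real) \<Rightarrow> nat \<Rightarrow> (nat \<Rightarrow> 'y) \<Rightarrow> real" where
  "filtering_denom \<pi> Q f k y =
     (if k = 1 then (\<Sum>x'\<in>UNIV. \<pi> $ x' * f x' (y 1))
      else (\<Sum>x'\<in>UNIV. \<Sum>x''\<in>UNIV. Q $ x' $ x'' * f x'' (y k) * filtering \<pi> Q f (k - 1) y x'))"

text \<open>\<open>smoothing \<pi> Q f n k y x\<close> is \<open>\<phi>\<^sub>k\<^sub>|\<^sub>n(x, y\<^sub>1\<^sub>:\<^sub>n)\<close> for \<open>1 \<le> k \<le> n\<close>.\<close>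

function smoothing ::
  "real^'k \<Rightarrow> real^'k^'k::finite \<Rightarrow> ('k \<Rightarrow> 'y \<Rightarrow> real) \<Rightarrow> nat \<Rightarrow> nat \<Rightarrow> (nat \<Rightarrow> 'y) \<Rightarrow> 'k \<Rightarrow> real" where
  "smoothing \<pi> Q f n k y x =
     (if k < n then
        (\<Sum>x'\<in>UNIV. Q $ x $ x' * filtering \<pi> Q f k y x /
             (\<Sum>z\<in>UNIV. Q $ z $ x' * filtering \<pi> Q f k y z) * smoothing \<pi> Q f n (Suc k) y x')
      else filtering \<pi> Q f n y x)"
  by pat_completeness auto
termination
  by (relation "Wellfounded.measure (\<lambda>(\<pi>, Q, f, n, k, y, x). n - k)") auto

declare smoothing.simps [simp del]

definition tv_dist :: "('k::finite \<Rightarrow> real) \<Rightarrow> ('k \<Rightarrow> real) \<Rightarrow> real" where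
  "tv_dist \<mu> \<nu> = (\<Sum>x\<in>UNIV. \<bar>\<mu> x - \<nu> x\<bar>)"

text \<open>Quotient with the convention that it is infinite, even for numerator 0, when the denominator
  vanishes (the library quotient on \<^typ>\<open>ennreal\<close> has \<open>0 / 0 = 0\<close>).\<close>

definition quot_top :: "ennreal \<Rightarrow> real \<Rightarrow> ennreal" where
  "quot_top a d = (if d = 0 then \<infinity> else a / ennreal d)"

end

theory Submission
  imports Defs
begin

text \<open>
  The true posterior is turned into the estimated one by exchanging true for estimated parameters
  one observation time after the other.  Each exchange, at time \<open>l\<close>, perturbs the posterior law of
  the state near \<open>l\<close> by at most \<open>\<parallel>Q - Qh\<parallel>/\<delta> + (\<Sum>x. \<bar>f x - fh x\<bar> (y l)) / (\<delta>\<^sup>2 \<Sum>x. f x (y l))\<close>, and its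
  effect on the state at time \<open>k\<close> decays geometrically: at rate \<open>1 - \<delta>\<close> for \<open>l \<le> k\<close>, where it travels
  forward through true transitions, and at rate \<open>1 - \<delta>h\<close> for \<open>l > k\<close>, where it travels backward
  through estimated ones.  Filtering only involves \<open>l \<le> k\<close>, so \<open>\<delta>h\<close> enters the smoothing bound
  only.  In expectation, conditionally on the first \<open>p\<close> observations each later observation has
  a density at most \<open>\<Sum>x. f x\<close>, which cancels the denominator.
\<close>

text \<open>The order of the exchanges keeps the two mixing constants apart: estimated parameters
  always sit before the switching time, true ones after it. So whatever lies between an exchange and
  the time \<open>k\<close> consists of one kind of parameter only. The obstacle is the
  normalisation, which makes both recursions nonlinear. Contraction is therefore stated for
  unnormalised vectors: \<open>u\<close> is close to a multiple of \<open>v\<close>, with an error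
  proportional to \<open>v\<close>. The multiple is left free, because it cancels in a difference of
  ratios. Each exchange is measured against the normaliser of the true side, which has a lower
  bound, so its size involves only the true minimum. The estimated minimum enters through the sum of
  the powers of \<open>1 - \<delta>h\<close> alone. The constant is \<open>2 / \<delta>\<close> from
  summing the decay times \<open>1 / \<delta>\<^sup>2\<close> from one exchange. For smoothing the
  decay sums to \<open>2 / \<delta> + 2 / \<delta>h\<close>, which is at most
  \<open>2 / (\<delta> * \<delta>h)\<close> because both minima are at most 1/2. The initial law is
  exchanged just once, with weight at most 2, so its error escapes the division by
  \<open>\<delta>h\<close>.\<close>

subsection \<open>Stability of the forward and backward recursions\<close>

text \<open>Doeblin's argument for ratios: \<open>u / v\<close> stays within \<open>w\<close> of a
  constant, and the laws proportional to \<open>P x z * v z\<close> have a common part of mass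
  \<open>d\<close>, so only mass \<open>1 - d\<close> can tell two values of \<open>x\<close> apart.
  The centre is existential because it moves at every step, here by \<open>d\<close> times the
  \<open>v\<close>-mean of the deviation. \<open>P\<close> is constrained through its entries alone,
  so that a transposed transition matrix qualifies as well.\<close>

lemma mixing_contraction:
  fixes P :: "'k::finite \<Rightarrow> 'k \<Rightarrow> real"
  assumes P: "\<And>x z. d \<le> P x z" "\<And>x z. P x z \<le> 1" and d: "0 \<le> d"
    and v: "\<And>x. 0 \<le> v x" and u: "\<And>x. \<bar>u x - c * v x\<bar> \<le> w * v x"
  shows "\<exists>c'. \<forall>x. \<bar>(\<Sum>z\<in>UNIV. P x z * u z) - c' * (\<Sum>z\<in>UNIV. P x z * v z)\<bar>
           \<le> (1 - d) * w * (\<Sum>z\<in>UNIV. P x z * v z)"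
proof (cases "(\<Sum>z\<in>UNIV. v z) = 0")
  case True
  then have "v z = 0" for z
    using v by (simp add: sum_nonneg_eq_0_iff)
  moreover from this have "u z = 0" for z
    using u[of z] by simp
  ultimately show ?thesis by simp
next
  case False
  define V where "V = (\<Sum>z\<in>UNIV. v z)"
  have V: "V > 0"
    using False v by (simp add: V_def sum_nonneg less_le)
  define t where "t z = u z - c * v z" for z
  define m where "m = (\<Sum>z\<in>UNIV. t z) / V"
  have "\<bar>(\<Sum>z\<in>UNIV. P x z * u z) - (c + d * m) * (\<Sum>z\<in>UNIV. P x z * v z)\<bar>
           \<le> (1 - d) * w * (\<Sum>z\<in>UNIV. P x z * v z)" for x
  proof -
    define W where "W = (\<Sum>z\<in>UNIV. P x z * v z)"
    have "W \<le> V"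
      unfolding W_def V_def using P v by (intro sum_mono) (simp add: mult_left_le_one_le order_trans[OF d])
    then have "W / V \<le> 1"
      using V by simp
    then have "d * (W / V) \<le> d"
      using mult_left_mono[OF _ d] by fastforce
    \<comment> \<open>Removing the common part \<open>d / V\<close> of the weights \<open>P x z / W\<close> leaves mass \<open>1 - d\<close>.\<close>
    then have q: "0 \<le> P x z - d * (W / V)" for z
      using P(1)[of x z] by linarith
    have "(\<Sum>z\<in>UNIV. P x z * u z) - (c + d * m) * W
        = (\<Sum>z\<in>UNIV. P x z * t z) - d * m * W"
      by (simp add: t_def W_def algebra_simps sum_subtractf sum.distrib sum_distrib_left)
    also have "\<dots> = (\<Sum>z\<in>UNIV. (P x z - d * (W / V)) * t z)"
      by (simp add: m_def algebra_simps sum_subtractf sum_distrib_left sum_divide_distrib)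
    finally have "\<bar>(\<Sum>z\<in>UNIV. P x z * u z) - (c + d * m) * W\<bar>
        \<le> (\<Sum>z\<in>UNIV. \<bar>(P x z - d * (W / V)) * t z\<bar>)"
      by simp
    also have "\<dots> \<le> (\<Sum>z\<in>UNIV. (P x z - d * (W / V)) * (w * v z))"
      using q u by (intro sum_mono) (simp add: abs_mult t_def mult_left_mono)
    also have "\<dots> = w * ((\<Sum>z\<in>UNIV. P x z * v z) - d * (W / V) * (\<Sum>z\<in>UNIV. v z))"
      by (simp only: sum_distrib_left sum_subtractf[symmetric]) (simp add: algebra_simps)
    also have "\<dots> = w * (W - d * (W / V) * V)"
      by (simp only: W_def[symmetric] V_def[symmetric])
    also have "\<dots> = (1 - d) * w * W"
      using V by (simp add: algebra_simps)
    finally show ?thesis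
      by (simp add: W_def)
  qed
  then show ?thesis by blast
qed

text \<open>Both quotients are means of \<open>u / v\<close>, so the unknown centre \<open>c\<close>
  cancels and only deviations of size \<open>w\<close> remain. The factor 2 counts the change of the
  numerator and that of the normaliser. In the applications \<open>\<mu>\<close> belongs to the true
  parameters, whose normaliser has a lower bound.\<close>

lemma ratio_diff:
  fixes \<mu> \<nu> u v :: "'k::finite \<Rightarrow> real"
  assumes v: "\<And>x. 0 \<le> v x" and u: "\<And>x. \<bar>u x - c * v x\<bar> \<le> w * v x" and \<nu>: "\<And>x. 0 \<le> \<nu> x"
    and pos: "0 < (\<Sum>x\<in>UNIV. \<mu> x * v x)" "0 < (\<Sum>x\<in>UNIV. \<nu> x * v x)"
  shows "\<bar>(\<Sum>x\<in>UNIV. \<mu> x * u x) / (\<Sum>x\<in>UNIV. \<mu> x * v x)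
           - (\<Sum>x\<in>UNIV. \<nu> x * u x) / (\<Sum>x\<in>UNIV. \<nu> x * v x)\<bar>
         \<le> 2 * w * ((\<Sum>x\<in>UNIV. \<bar>\<mu> x - \<nu> x\<bar> * v x) / (\<Sum>x\<in>UNIV. \<mu> x * v x))"
proof -
  define t where "t x = u x - c * v x" for x
  define m where "m = (\<Sum>x\<in>UNIV. \<mu> x * v x)"
  define n where "n = (\<Sum>x\<in>UNIV. \<nu> x * v x)"
  define E where "E = (\<Sum>x\<in>UNIV. \<bar>\<mu> x - \<nu> x\<bar> * v x)"
  define a where "a = (\<Sum>x\<in>UNIV. (\<mu> x - \<nu> x) * t x)"
  define b where "b = (\<Sum>x\<in>UNIV. \<nu> x * t x)"
  have mn: "m > 0" "n > 0"
    using pos by (simp_all add: m_def n_def)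
  have a: "\<bar>a\<bar> \<le> w * E"
  proof -
    have "\<bar>a\<bar> \<le> (\<Sum>x\<in>UNIV. \<bar>(\<mu> x - \<nu> x) * t x\<bar>)"
      unfolding a_def by simp
    also have "\<dots> \<le> (\<Sum>x\<in>UNIV. \<bar>\<mu> x - \<nu> x\<bar> * (w * v x))"
      using u by (intro sum_mono) (simp add: abs_mult t_def mult_left_mono)
    finally show ?thesis
      by (simp add: E_def sum_distrib_left mult_ac)
  qed
  have b: "\<bar>b\<bar> \<le> w * n"
  proof -
    have "\<bar>b\<bar> \<le> (\<Sum>x\<in>UNIV. \<bar>\<nu> x * t x\<bar>)"
      unfolding b_def by simp
    also have "\<dots> \<le> (\<Sum>x\<in>UNIV. \<nu> x * (w * v x))"
      using u \<nu> by (intro sum_mono) (simp add: abs_mult t_def mult_left_mono)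
    finally show ?thesis
      by (simp add: n_def sum_distrib_left mult_ac)
  qed
  have nm: "\<bar>n - m\<bar> \<le> E"
  proof -
    have "n - m = (\<Sum>x\<in>UNIV. (\<nu> x - \<mu> x) * v x)"
      by (simp add: n_def m_def algebra_simps sum_subtractf)
    also have "\<bar>\<dots>\<bar> \<le> (\<Sum>x\<in>UNIV. \<bar>(\<nu> x - \<mu> x) * v x\<bar>)"
      by simp
    also have "\<dots> = E"
      using v by (simp add: E_def abs_mult abs_minus_commute)
    finally show ?thesis .
  qed
  have 1: "(\<Sum>x\<in>UNIV. \<mu> x * u x) = a + b + c * m" "(\<Sum>x\<in>UNIV. \<nu> x * u x) = b + c * n"
    by (simp_all add: a_def b_def m_def n_def t_def algebra_simps sum_subtractf sum.distrib sum_distrib_left)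
  \<comment> \<open>The second mean enters through \<open>b / n\<close>, which is at most
    \<open>w\<close> in size whatever \<open>n\<close> is. This keeps \<open>n\<close> out of the
    final denominator.\<close>
  have "(\<Sum>x\<in>UNIV. \<mu> x * u x) / m - (\<Sum>x\<in>UNIV. \<nu> x * u x) / n = a / m + (b / n) * ((n - m) / m)"
    using mn by (simp add: 1 field_simps)
  also have "\<bar>\<dots>\<bar> \<le> \<bar>a\<bar> / m + \<bar>b\<bar> / n * (\<bar>n - m\<bar> / m)"
    using mn by (intro order_trans[OF abs_triangle_ineq]) (simp add: abs_mult)
  also have "\<dots> \<le> w * E / m + w * (E / m)"
  proof (intro add_mono mult_mono)
    show "\<bar>b\<bar> / n \<le> w" using b mn by (simp add: field_simps)
    then show "0 \<le> w" using mn by (auto intro: order_trans[rotated])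
  qed (use a b nm mn in \<open>auto simp: divide_right_mono\<close>)
  finally show ?thesis
    by (simp add: m_def n_def E_def)
qed

text \<open>One factor \<open>d\<close> is lost in the lower bound for \<open>den\<close>. The
  likelihood error loses another when the weight \<open>v\<close> is removed, since the values of
  \<open>v\<close> agree only up to a factor \<open>1 / d\<close>. The term with \<open>D\<close>
  carries the same weighted sum of \<open>g\<close> as the normaliser and cancels against it.
  \<open>T\<close> is a total mass, which cancels too.\<close>

lemma relative_error:
  fixes g gh v :: "'k::finite \<Rightarrow> real"
  assumes d: "0 < d" and T: "0 < T" and D: "0 \<le> D" and g: "\<And>x. 0 \<le> g x" "0 < (\<Sum>x\<in>UNIV. g x)"
    and v: "\<And>x. 0 < v x" "\<And>x z. d * v x \<le> v z"
    and num: "num \<le> (\<Sum>x\<in>UNIV. T * (D * g x + \<bar>g x - gh x\<bar>) * v x)"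
    and den: "d * T * (\<Sum>x\<in>UNIV. g x * v x) \<le> den"
  shows "num / den \<le> D / d + (\<Sum>x\<in>UNIV. \<bar>g x - gh x\<bar>) / (\<Sum>x\<in>UNIV. g x) / d\<^sup>2"
proof -
  define e where "e = (\<Sum>x\<in>UNIV. \<bar>g x - gh x\<bar>)"
  define s where "s = (\<Sum>x\<in>UNIV. g x)"
  define G where "G = (\<Sum>x\<in>UNIV. g x * v x)"
  have e: "0 \<le> e" by (simp add: e_def sum_nonneg)
  have s: "0 < s" using g by (simp add: s_def)
  have vG: "d * v z * s \<le> G" for z
    unfolding G_def s_def sum_distrib_left
    using v g by (intro sum_mono) (simp add: mult.commute mult_left_mono)
  \<comment> \<open>An arbitrary state, taken only to see that \<open>G\<close> is positive.\<close>
  have "0 < d * v undefined * s" using d v s by simp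
  then have G: "0 < G" using vG by (rule less_le_trans)
  have "d * s * (\<Sum>x\<in>UNIV. \<bar>g x - gh x\<bar> * v x) = (\<Sum>x\<in>UNIV. \<bar>g x - gh x\<bar> * (d * v x * s))"
    by (simp add: sum_distrib_left mult_ac)
  also have "\<dots> \<le> (\<Sum>x\<in>UNIV. \<bar>g x - gh x\<bar> * G)"
    by (intro sum_mono mult_left_mono vG) simp
  also have "\<dots> = e * G" by (simp add: e_def sum_distrib_right)
  finally have eG: "(\<Sum>x\<in>UNIV. \<bar>g x - gh x\<bar> * v x) \<le> e * G / (d * s)"
    using d s by (simp add: field_simps)
  have "num \<le> T * (D * G + (\<Sum>x\<in>UNIV. \<bar>g x - gh x\<bar> * v x))"
    using num by (simp add: G_def sum_distrib_left sum.distrib algebra_simps)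
  also have "\<dots> \<le> T * (D * G + e * G / (d * s))"
    using eG T by simp
  finally have n: "num \<le> T * (D * G + e * G / (d * s))" .
  have dG: "0 < d * T * G" using d T G by simp
  have "num / den \<le> T * (D * G + e * G / (d * s)) / (d * T * G)"
    using n den dG D e d T s G by (intro frac_le) (auto simp: G_def[symmetric])
  also have "\<dots> = D / d + e / s / d\<^sup>2"
    using d T G s by (simp add: field_simps power2_eq_square)
  finally show ?thesis by (simp add: e_def s_def)
qed

text \<open>From here to the link with \<^const>\<open>filtering\<close>, time starts at 0: the likelihood \<open>g j x\<close> stands for
  \<open>f x (y (Suc j))\<close>.  In \<open>propagate Q g j a m\<close> and \<open>backward Q g m j v\<close>, \<open>j\<close> is the earlier time
  and \<open>m\<close> the number of steps.\<close>

primrec propagate :: "('k::finite \<Rightarrow> 'k \<Rightarrow> real) \<Rightarrow> (nat \<Rightarrow> 'k \<Rightarrow> real) \<Rightarrow> nat \<Rightarrow> ('k \<Rightarrow> real) \<Rightarrow> nat \<Rightarrow> 'k \<Rightarrow> real" where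
  "propagate Q g j a 0 x = a x"
| "propagate Q g j a (Suc m) x = (\<Sum>z\<in>UNIV. propagate Q g j a m z * Q z x) * g (j + Suc m) x"

primrec backward :: "('k::finite \<Rightarrow> 'k \<Rightarrow> real) \<Rightarrow> (nat \<Rightarrow> 'k \<Rightarrow> real) \<Rightarrow> nat \<Rightarrow> nat \<Rightarrow> ('k \<Rightarrow> real) \<Rightarrow> 'k \<Rightarrow> real" where
  "backward Q g 0 j v x = v x"
| "backward Q g (Suc m) j v x = (\<Sum>z\<in>UNIV. Q x z * (g (Suc j) z * backward Q g m (Suc j) v z))"

text \<open>The forward variables of the forward-backward algorithm; the matching backward variables
  are \<open>backward Q g m j (\<lambda>_. 1)\<close>. Neither is normalised, which keeps both
  recursions linear.\<close>

definition forward :: "('k::finite \<Rightarrow> real) \<Rightarrow> ('k \<Rightarrow> 'k \<Rightarrow> real) \<Rightarrow> (nat \<Rightarrow> 'k \<Rightarrow> real) \<Rightarrow> nat \<Rightarrow> 'k \<Rightarrow> real" where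
  "forward p Q g = propagate Q g 0 (\<lambda>x. p x * g 0 x)"

section \<open>Linear algebra of the two recursions and their geometric forgetting\<close>

lemma propagate_nonneg:
  assumes "\<And>x z. 0 \<le> Q x z" "\<And>j x. 0 \<le> g j x" "\<And>x. 0 \<le> a x"
  shows "0 \<le> propagate Q g j a m x"
  using assms by (induction m arbitrary: x) (auto intro!: mult_nonneg_nonneg sum_nonneg)

lemma backward_nonneg:
  assumes "\<And>x z. 0 \<le> Q x z" "\<And>j x. 0 \<le> g j x" "\<And>x. 0 \<le> v x"
  shows "0 \<le> backward Q g m j v x"
  using assms by (induction m arbitrary: x j) (auto intro!: mult_nonneg_nonneg sum_nonneg)

lemma propagate_add: "propagate Q g (j + m) (propagate Q g j a m) i = propagate Q g j a (m + i)"
  by (induction i) (auto simp: fun_eq_iff add_ac)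

lemma backward_add: "backward Q g m j (backward Q g i (j + m) v) = backward Q g (m + i) j v"
proof (induction m arbitrary: j)
  case (Suc m)
  show ?case
    using Suc[of "Suc j"] by (simp add: fun_eq_iff)
qed (simp add: fun_eq_iff)

text \<open>The two recursions are adjoint. A posterior mean can therefore be written at any
  intermediate time, in particular at the one where parameters are exchanged.\<close>

lemma propagate_backward:
  "(\<Sum>x\<in>UNIV. propagate Q g j a m x * v x) = (\<Sum>x\<in>UNIV. a x * backward Q g m j v x)"
proof (induction m arbitrary: v)
  case (Suc m)
  have "(\<Sum>x\<in>UNIV. propagate Q g j a (Suc m) x * v x)
      = (\<Sum>z\<in>UNIV. propagate Q g j a m z * (\<Sum>x\<in>UNIV. Q z x * (g (Suc (j + m)) x * v x)))"
    unfolding propagate.simps sum_distrib_right sum_distrib_left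
    by (subst sum.swap) (simp add: mult_ac)
  also have "\<dots> = (\<Sum>z\<in>UNIV. propagate Q g j a m z * backward Q g 1 (j + m) v z)"
    by simp
  also have "\<dots> = (\<Sum>x\<in>UNIV. a x * backward Q g m j (backward Q g 1 (j + m) v) x)"
    by (rule Suc)
  finally show ?case
    unfolding backward_add by simp
qed simp

text \<open>Divided by \<open>backward Q g m j v\<close>, this concerns the conditional mean of
  \<open>h\<close> given the state \<open>m\<close> steps earlier, which depends on that state less
  and less. A likelihood multiplies both vectors alike and leaves their ratio unchanged, so all the
  contraction comes from the transitions.\<close>

lemma backward_contraction:
  assumes Q: "\<And>x z. d \<le> Q x z" "\<And>x z. Q x z \<le> 1" and d: "0 \<le> d"
    and g: "\<And>j x. 0 \<le> g j x" and v: "\<And>x. 0 \<le> v x" and h: "\<And>x. \<bar>h x\<bar> \<le> 1"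
  shows "\<exists>c. \<forall>x. \<bar>backward Q g m j (\<lambda>x. h x * v x) x - c * backward Q g m j v x\<bar>
           \<le> (1 - d) ^ m * backward Q g m j v x"
proof (induction m arbitrary: j)
  case 0
  have "\<bar>h x * v x - 0 * v x\<bar> \<le> 1 * v x" for x
    using h[of x] v[of x] by (simp add: abs_mult mult_left_le_one_le)
  then show ?case by (intro exI[of _ 0]) simp
next
  case (Suc m)
  from Suc[of "Suc j"] obtain c where
    c: "\<And>x. \<bar>backward Q g m (Suc j) (\<lambda>x. h x * v x) x - c * backward Q g m (Suc j) v x\<bar>
           \<le> (1 - d) ^ m * backward Q g m (Suc j) v x" by blast
  have *: "\<bar>g (Suc j) x * backward Q g m (Suc j) (\<lambda>x. h x * v x) x
            - c * (g (Suc j) x * backward Q g m (Suc j) v x)\<bar>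
         \<le> (1 - d) ^ m * (g (Suc j) x * backward Q g m (Suc j) v x)" for x
    using mult_left_mono[OF c[of x] g[of "Suc j" x]] g[of "Suc j" x]
    by (simp add: abs_mult[symmetric] abs_mult_pos' algebra_simps)
  have "0 \<le> g (Suc j) x * backward Q g m (Suc j) v x" for x
    using order_trans[OF d Q(1)] g v by (simp add: backward_nonneg)
  from mixing_contraction[OF Q d this *] show ?case by simp
qed

text \<open>The time reversal of \<open>backward_contraction\<close>: a weight \<open>h\<close> put
  on the initial states fades into a constant factor. The matrix acts transposed, and entrywise
  bounds survive transposition.\<close>

lemma propagate_contraction:
  assumes Q: "\<And>x z. d \<le> Q x z" "\<And>x z. Q x z \<le> 1" and d: "0 \<le> d"
    and g: "\<And>j x. 0 \<le> g j x" and v: "\<And>x. 0 \<le> v x" and h: "\<And>x. \<bar>h x\<bar> \<le> 1"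
  shows "\<exists>c. \<forall>x. \<bar>propagate Q g j (\<lambda>x. h x * v x) m x - c * propagate Q g j v m x\<bar>
           \<le> (1 - d) ^ m * propagate Q g j v m x"
proof (induction m)
  case 0
  have "\<bar>h x * v x - 0 * v x\<bar> \<le> 1 * v x" for x
    using h[of x] v[of x] by (simp add: abs_mult mult_left_le_one_le)
  then show ?case by (intro exI[of _ 0]) simp
next
  case (Suc m)
  then obtain c where
    c: "\<And>x. \<bar>propagate Q g j (\<lambda>x. h x * v x) m x - c * propagate Q g j v m x\<bar>
           \<le> (1 - d) ^ m * propagate Q g j v m x" by blast
  have "0 \<le> propagate Q g j v m x" for x
    using order_trans[OF d Q(1)] g v by (simp add: propagate_nonneg)
  from mixing_contraction[where P = "\<lambda>x z. Q z x" and v = "propagate Q g j v m"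
      and u = "propagate Q g j (\<lambda>x. h x * v x) m", OF Q d this c] obtain c' where
    c': "\<And>x. \<bar>(\<Sum>z\<in>UNIV. Q z x * propagate Q g j (\<lambda>x. h x * v x) m z)
                - c' * (\<Sum>z\<in>UNIV. Q z x * propagate Q g j v m z)\<bar>
           \<le> (1 - d) * (1 - d) ^ m * (\<Sum>z\<in>UNIV. Q z x * propagate Q g j v m z)" by blast
  have "\<bar>propagate Q g j (\<lambda>x. h x * v x) (Suc m) x - c' * propagate Q g j v (Suc m) x\<bar>
      \<le> (1 - d) ^ Suc m * propagate Q g j v (Suc m) x" for x
    using mult_left_mono[OF c'[of x] g[of "j + Suc m" x]] g[of "j + Suc m" x]
    by (simp add: abs_mult[symmetric] abs_mult_pos' algebra_simps)
  then show ?case by blast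
qed

text \<open>One transition with entries between \<open>d\<close> and 1 is enough: all values lie
  between \<open>d * S\<close> and \<open>S\<close>, where the likelihood-weighted sum
  \<open>S\<close> does not see the starting state. Positive likelihood sums along the way make
  \<open>S\<close> positive.\<close>

lemma backward_ratio:
  assumes Q: "\<And>x z. d \<le> Q x z" "\<And>x z. Q x z \<le> 1" and d: "0 < d" "d \<le> 1"
    and g: "\<And>j x. 0 \<le> g j x" and s: "\<And>i. j < i \<Longrightarrow> i \<le> j + m \<Longrightarrow> 0 < (\<Sum>x\<in>UNIV. g i x)"
  shows "0 < backward Q g m j (\<lambda>_. 1) x" "d * backward Q g m j (\<lambda>_. 1) x \<le> backward Q g m j (\<lambda>_. 1) z"
proof -
  have "0 < backward Q g m j (\<lambda>_. 1) x \<and> d * backward Q g m j (\<lambda>_. 1) x \<le> backward Q g m j (\<lambda>_. 1) z"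
    using s
  proof (induction m arbitrary: j x z)
    case (Suc m)
    let ?b = "backward Q g m (Suc j) (\<lambda>_. 1)"
    have IH: "0 < ?b x" for x
      using Suc.IH[of "Suc j" x] Suc.prems by auto
    define S where "S = (\<Sum>z\<in>UNIV. g (Suc j) z * ?b z)"
    obtain z0 where "g (Suc j) z0 > 0"
    proof -
      have "(\<Sum>x\<in>UNIV. g (Suc j) x) \<noteq> 0"
        using Suc.prems[of "Suc j"] by simp
      then obtain z0 where "g (Suc j) z0 \<noteq> 0"
        by (auto elim: sum.not_neutral_contains_not_neutral)
      then show ?thesis using g[of "Suc j" z0] that[of z0] by linarith
    qed
    then have "0 < S" unfolding S_def
      using IH g by (intro sum_pos2[of _ z0]) (auto simp: less_imp_le)
    moreover have "d * S \<le> backward Q g (Suc m) j (\<lambda>_. 1) x" for x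
      unfolding S_def sum_distrib_left backward.simps
      using Q g IH by (intro sum_mono mult_right_mono) (auto simp: less_imp_le)
    moreover have "backward Q g (Suc m) j (\<lambda>_. 1) x \<le> S" for x
      unfolding S_def backward.simps
      using Q g IH order_trans[OF less_imp_le[OF d(1)] Q(1)]
      by (intro sum_mono mult_left_le_one_le) (auto simp: less_imp_le)
    ultimately show ?case
      using d by (meson less_le_trans mult_le_cancel_left_pos mult_pos_pos order_trans)
  qed (use d in simp)
  then show "0 < backward Q g m j (\<lambda>_. 1) x" "d * backward Q g m j (\<lambda>_. 1) x \<le> backward Q g m j (\<lambda>_. 1) z"
    by auto
qed

section \<open>Exchange of the parameters at a single time\<close>

locale perturbed_recursions =
  fixes p ph :: "'k::finite \<Rightarrow> real" and Q Qh :: "'k \<Rightarrow> 'k \<Rightarrow> real" and g gh :: "nat \<Rightarrow> 'k \<Rightarrow> real"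
    and d D0 D :: real and N :: nat
  assumes d: "0 < d" "d \<le> 1"
    and p: "\<And>x. d \<le> p x" and ph: "\<And>x. 0 \<le> ph x" "\<And>x. ph x \<le> 1"
    and Q: "\<And>x z. d \<le> Q x z" "\<And>x z. Q x z \<le> 1" and Qh: "\<And>x z. 0 \<le> Qh x z" "\<And>x z. Qh x z \<le> 1"
    and g: "\<And>j x. 0 \<le> g j x" and gh: "\<And>j x. 0 \<le> gh j x"
    and D0: "\<And>x. \<bar>p x - ph x\<bar> \<le> D0" and D: "\<And>x z. \<bar>Q x z - Qh x z\<bar> \<le> D"
    and pos: "\<And>j. j \<le> N \<Longrightarrow> 0 < (\<Sum>x\<in>UNIV. g j x)"
    and pos_hat: "\<And>j. j \<le> N \<Longrightarrow> 0 < (\<Sum>x\<in>UNIV. forward ph Qh gh j x)"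
begin

text \<open>\<open>\<alpha>\<close> carries the estimated parameters and \<open>\<beta>\<close> the
  true ones, so \<open>\<alpha> j x * \<beta> j x\<close> is the unnormalised law at time
  \<open>j\<close> of the hybrid that switches right after \<open>j\<close>. Positive lower bounds
  are imposed on the true entries; on the estimated side the positive normalisers of
  \<open>pos_hat\<close> take their place.\<close>

abbreviation \<alpha> :: "nat \<Rightarrow> 'k \<Rightarrow> real" where "\<alpha> \<equiv> forward ph Qh gh"

definition \<beta> :: "nat \<Rightarrow> 'k \<Rightarrow> real" where "\<beta> j = backward Q g (N - j) j (\<lambda>_. 1)"

text \<open>An exchange at \<open>j\<close> concerns the transition into \<open>j\<close> and the
  likelihood at \<open>j\<close>; at time 0 the initial law stands in for the transition.\<close>

definition err :: "nat \<Rightarrow> real" where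
  "err j = (if j = 0 then D0 else D) / d + (\<Sum>x\<in>UNIV. \<bar>g j x - gh j x\<bar>) / (\<Sum>x\<in>UNIV. g j x) / d\<^sup>2"

lemma Q_nonneg: "0 \<le> Q x z"
  using d(1) Q(1) by (meson less_imp_le order_trans)

lemma D_nonneg: "0 \<le> D0" "0 \<le> D"
  using D0 D by (meson abs_ge_zero order_trans)+

lemma \<beta>_pos: "j \<le> N \<Longrightarrow> 0 < \<beta> j x"
  and \<beta>_ratio: "j \<le> N \<Longrightarrow> d * \<beta> j x \<le> \<beta> j z"
  using backward_ratio[where Q = Q and g = g and j = j and m = "N - j", OF Q d g] pos by (auto simp: \<beta>_def)

lemma \<beta>_step: "j < N \<Longrightarrow> \<beta> j = (\<lambda>x. \<Sum>z\<in>UNIV. Q x z * (g (Suc j) z * \<beta> (Suc j) z))"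
  by (simp add: \<beta>_def Suc_diff_Suc[symmetric] fun_eq_iff)

lemma \<beta>_add: "k \<le> N \<Longrightarrow> j \<le> k \<Longrightarrow> \<beta> j = backward Q g (k - j) j (\<beta> k)"
  unfolding \<beta>_def using backward_add[of Q g "k - j" j "N - k"] by simp

lemma \<alpha>_nonneg: "0 \<le> \<alpha> j x"
  unfolding forward_def using ph Qh gh by (intro propagate_nonneg) auto

lemma \<alpha>_Suc: "\<alpha> (Suc j) x = (\<Sum>z\<in>UNIV. \<alpha> j z * Qh z x) * gh (Suc j) x"
  by (simp add: forward_def)

lemma sum_\<alpha>_pos:
  assumes "j \<le> N" "\<And>x. 0 < v x"
  shows "0 < (\<Sum>x\<in>UNIV. \<alpha> j x * v x)"
proof -
  obtain z where "\<alpha> j z \<noteq> 0"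
    using pos_hat[OF assms(1)] by (metis less_irrefl sum.neutral)
  then show ?thesis
    using \<alpha>_nonneg[of j z] assms(2)
    by (intro sum_pos2[of _ z]) (auto simp: \<alpha>_nonneg less_imp_le less_le)
qed

text \<open>\<open>q\<close> and \<open>qh\<close> are the weights predicted for time
  \<open>j\<close> before the observation at \<open>j\<close> is used, and \<open>u\<close> is
  \<open>h\<close> pulled back to \<open>j\<close> through true parameters, whence the rate
  \<open>1 - d\<close>. The mass \<open>T\<close> and the generic \<open>B\<close> let one lemma
  treat the initial law, with \<open>T = 1\<close>, and the transitions alike.\<close>

lemma forward_replacement:
  assumes k: "j \<le> k" "k \<le> N" and h: "\<And>x. \<bar>h x\<bar> \<le> 1"
    and T: "0 < T" and B: "0 \<le> B" and q: "\<And>x. d * T \<le> q x" and qh: "\<And>x. 0 \<le> qh x" "\<And>x. qh x \<le> T"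
    and q_diff: "\<And>x. \<bar>q x - qh x\<bar> \<le> T * B"
    and qh_pos: "0 < (\<Sum>x\<in>UNIV. qh x * gh j x * \<beta> j x)"
    and u: "u = backward Q g (k - j) j (\<lambda>x. h x * \<beta> k x)"
  shows "\<bar>(\<Sum>x\<in>UNIV. q x * g j x * u x) / (\<Sum>x\<in>UNIV. q x * g j x * \<beta> j x)
         - (\<Sum>x\<in>UNIV. qh x * gh j x * u x) / (\<Sum>x\<in>UNIV. qh x * gh j x * \<beta> j x)\<bar>
         \<le> 2 * (1 - d) ^ (k - j) * (B / d + (\<Sum>x\<in>UNIV. \<bar>g j x - gh j x\<bar>) / (\<Sum>x\<in>UNIV. g j x) / d\<^sup>2)"
proof -
  have jN: "j \<le> N" using k by simp
  note b = \<beta>_pos[OF jN] \<beta>_ratio[OF jN]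
  have "0 \<le> \<beta> k x" for x using \<beta>_pos[OF k(2)] less_imp_le by blast
  then obtain c where c: "\<And>x. \<bar>u x - c * \<beta> j x\<bar> \<le> (1 - d) ^ (k - j) * \<beta> j x"
    using backward_contraction[where Q = Q and g = g and v = "\<beta> k" and h = h and m = "k - j" and j = j,
        OF Q less_imp_le[OF d(1)] g] h
    unfolding \<beta>_add[OF k(2,1)] u by blast
  have den: "d * T * (\<Sum>x\<in>UNIV. g j x * \<beta> j x) \<le> (\<Sum>x\<in>UNIV. q x * g j x * \<beta> j x)"
    unfolding sum_distrib_left
  proof (rule sum_mono)
    fix x
    show "d * T * (g j x * \<beta> j x) \<le> q x * g j x * \<beta> j x"
      using mult_right_mono[OF q[of x], of "g j x * \<beta> j x"] g[of j x] b(1)[of x] by (simp add: mult_ac)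
  qed
  obtain z where z: "g j z \<noteq> 0"
    using pos[OF jN] by (metis less_irrefl sum.neutral)
  have "0 < (\<Sum>x\<in>UNIV. g j x * \<beta> j x)"
    using g[of j] b(1) z by (intro sum_pos2[of _ z]) (auto simp: less_imp_le less_le)
  then have q_pos: "0 < (\<Sum>x\<in>UNIV. q x * g j x * \<beta> j x)"
    using den d T by (meson less_le_trans mult_pos_pos)
  have num: "(\<Sum>x\<in>UNIV. \<bar>q x * g j x - qh x * gh j x\<bar> * \<beta> j x)
       \<le> (\<Sum>x\<in>UNIV. T * (B * g j x + \<bar>g j x - gh j x\<bar>) * \<beta> j x)"
  proof (intro sum_mono mult_right_mono)
    fix x
    \<comment> \<open>The prediction error is paired with the true likelihood, which also appears in
      the normaliser; the likelihood error is paired with \<open>qh\<close>, which is at most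
      \<open>T\<close>.\<close>
    have "q x * g j x - qh x * gh j x = (q x - qh x) * g j x + qh x * (g j x - gh j x)"
      by (simp add: algebra_simps)
    also have "\<bar>\<dots>\<bar> \<le> \<bar>q x - qh x\<bar> * g j x + qh x * \<bar>g j x - gh j x\<bar>"
      using abs_triangle_ineq[of "(q x - qh x) * g j x" "qh x * (g j x - gh j x)"] g[of j x] qh(1)[of x]
      by (simp add: abs_mult)
    also have "\<dots> \<le> T * B * g j x + T * \<bar>g j x - gh j x\<bar>"
      using q_diff qh g by (intro add_mono mult_right_mono) auto
    finally show "\<bar>q x * g j x - qh x * gh j x\<bar> \<le> T * (B * g j x + \<bar>g j x - gh j x\<bar>)"
      by (simp add: algebra_simps)
  qed (use b(1) less_imp_le in auto)
  have "(\<Sum>x\<in>UNIV. \<bar>q x * g j x - qh x * gh j x\<bar> * \<beta> j x) / (\<Sum>x\<in>UNIV. q x * g j x * \<beta> j x)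
      \<le> B / d + (\<Sum>x\<in>UNIV. \<bar>g j x - gh j x\<bar>) / (\<Sum>x\<in>UNIV. g j x) / d\<^sup>2"
    by (rule relative_error[OF d(1) T B g pos[OF jN] b num den])
  moreover have "0 \<le> qh x * gh j x" for x using qh gh by simp
  ultimately show ?thesis
    using ratio_diff[of "\<beta> j" u c "(1 - d) ^ (k - j)" "\<lambda>x. qh x * gh j x" "\<lambda>x. q x * g j x"]
      b(1) c q_pos qh_pos d
    by (smt (verit, best) mult_left_mono zero_le_power)
qed

text \<open>The second ratio is the mean of \<open>h\<close> at time \<open>k\<close> under the posterior in which the estimated
  parameters act up to time \<open>j\<close> and the true ones afterwards.\<close>

lemma forward_telescope:
  assumes "k \<le> N" and h: "\<And>x. \<bar>h x\<bar> \<le> 1" and "j \<le> k"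
  shows "\<bar>(\<Sum>x\<in>UNIV. forward p Q g k x * (h x * \<beta> k x)) / (\<Sum>x\<in>UNIV. forward p Q g k x * \<beta> k x)
         - (\<Sum>x\<in>UNIV. \<alpha> j x * backward Q g (k - j) j (\<lambda>x. h x * \<beta> k x) x) / (\<Sum>x\<in>UNIV. \<alpha> j x * \<beta> j x)\<bar>
         \<le> (\<Sum>i\<le>j. 2 * (1 - d) ^ (k - i) * err i)"
  using assms(3)
proof (induction j)
  case 0
  have 1: "(\<Sum>x\<in>UNIV. forward p Q g k x * v x) = (\<Sum>x\<in>UNIV. p x * g 0 x * backward Q g k 0 v x)" for v
    unfolding forward_def by (rule propagate_backward)
  have 2: "\<alpha> 0 x = ph x * gh 0 x" for x
    by (simp add: forward_def)
  have "\<beta> 0 = backward Q g k 0 (\<beta> k)"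
    using \<beta>_add[OF assms(1), of 0] by simp
  have pos0: "0 < (\<Sum>x\<in>UNIV. \<alpha> 0 x * \<beta> 0 x)"
    by (rule sum_\<alpha>_pos) (simp_all add: \<beta>_pos)
  have "\<bar>(\<Sum>x\<in>UNIV. p x * g 0 x * backward Q g k 0 (\<lambda>x. h x * \<beta> k x) x) / (\<Sum>x\<in>UNIV. p x * g 0 x * \<beta> 0 x)
         - (\<Sum>x\<in>UNIV. \<alpha> 0 x * backward Q g k 0 (\<lambda>x. h x * \<beta> k x) x) / (\<Sum>x\<in>UNIV. \<alpha> 0 x * \<beta> 0 x)\<bar>
         \<le> 2 * (1 - d) ^ (k - 0) * err 0"
    unfolding err_def 2 if_P[OF refl]
    by (rule forward_replacement[where T = 1]) (use pos0 assms D_nonneg p ph D0 in \<open>simp_all add: 2\<close>)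
  then show ?case
    by (simp add: 1 \<open>\<beta> 0 = _\<close>)
next
  case (Suc j)
  define u where "u j = backward Q g (k - j) j (\<lambda>x. h x * \<beta> k x)" for j
  define q where "q x = (\<Sum>z\<in>UNIV. \<alpha> j z * Q z x)" for x
  define qh where "qh x = (\<Sum>z\<in>UNIV. \<alpha> j z * Qh z x)" for x
  define T where "T = (\<Sum>x\<in>UNIV. \<alpha> j x)"
  have jN: "j < N" "j < k" using Suc.prems assms by auto
  have T: "0 < T" using pos_hat[of j] jN by (simp add: T_def)
  have u_step: "u j = backward Q g 1 j (u (Suc j))"
    using backward_add[of Q g 1 j "k - Suc j"] jN by (simp add: u_def Suc_diff_Suc)
  have \<beta>_step: "\<beta> j = backward Q g 1 j (\<beta> (Suc j))"
    using \<beta>_add[of "Suc j" j] jN by (simp add: Suc_diff_le)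
  \<comment> \<open>Adjointness transfers one true transition from the test function to
    \<open>\<alpha> j\<close>. This rewrites the hybrid at \<open>j\<close> as a ratio at
    \<open>Suc j\<close> with weights \<open>q\<close>, a single exchange away from the next
    hybrid.\<close>
  have step: "(\<Sum>x\<in>UNIV. \<alpha> j x * backward Q g 1 j v x) = (\<Sum>x\<in>UNIV. q x * g (Suc j) x * v x)" for v
    using propagate_backward[of Q g j "\<alpha> j" 1 v] by (simp add: q_def)
  have "d * T \<le> q x" for x
    unfolding T_def q_def sum_distrib_left mult.commute[of d] using Q \<alpha>_nonneg
    by (intro sum_mono mult_left_mono) auto
  moreover have "0 \<le> qh x" "qh x \<le> T" for x
    unfolding T_def qh_def using Qh \<alpha>_nonneg
    by (auto intro!: sum_nonneg sum_mono mult_right_le_one_le)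
  moreover have "\<bar>q x - qh x\<bar> \<le> T * D" for x
  proof -
    have "q x - qh x = (\<Sum>z\<in>UNIV. \<alpha> j z * (Q z x - Qh z x))"
      by (simp add: q_def qh_def sum_subtractf algebra_simps)
    also have "\<bar>\<dots>\<bar> \<le> (\<Sum>z\<in>UNIV. \<bar>\<alpha> j z * (Q z x - Qh z x)\<bar>)"
      by simp
    also have "\<dots> \<le> T * D"
      unfolding T_def sum_distrib_right using D \<alpha>_nonneg
      by (intro sum_mono) (simp add: abs_mult mult_left_mono)
    finally show ?thesis .
  qed
  moreover have \<alpha>S: "\<alpha> (Suc j) x = qh x * gh (Suc j) x" for x
    by (simp add: \<alpha>_Suc qh_def)
  moreover have "0 < (\<Sum>x\<in>UNIV. \<alpha> (Suc j) x * \<beta> (Suc j) x)"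
    using jN \<beta>_pos by (intro sum_\<alpha>_pos) auto
  ultimately have "\<bar>(\<Sum>x\<in>UNIV. q x * g (Suc j) x * u (Suc j) x) / (\<Sum>x\<in>UNIV. q x * g (Suc j) x * \<beta> (Suc j) x)
     - (\<Sum>x\<in>UNIV. \<alpha> (Suc j) x * u (Suc j) x) / (\<Sum>x\<in>UNIV. \<alpha> (Suc j) x * \<beta> (Suc j) x)\<bar>
         \<le> 2 * (1 - d) ^ (k - Suc j) * err (Suc j)"
    using forward_replacement[of "Suc j" k h T D q qh "u (Suc j)"] Suc.prems assms h T D_nonneg
    by (simp add: err_def u_def)
  moreover have "\<bar>(\<Sum>x\<in>UNIV. forward p Q g k x * (h x * \<beta> k x)) / (\<Sum>x\<in>UNIV. forward p Q g k x * \<beta> k x)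
         - (\<Sum>x\<in>UNIV. q x * g (Suc j) x * u (Suc j) x) / (\<Sum>x\<in>UNIV. q x * g (Suc j) x * \<beta> (Suc j) x)\<bar>
         \<le> (\<Sum>i\<le>j. 2 * (1 - d) ^ (k - i) * err i)"
    using Suc.IH Suc.prems by (simp only: u_def[symmetric] u_step \<beta>_step step)
  ultimately show ?case
    by (simp only: sum.atMost_Suc u_def[symmetric])
qed

text \<open>Past and future swap roles: the weights \<open>h x * \<alpha> k x\<close> are pushed
  through estimated transitions up to \<open>j\<close> and approach a multiple of
  \<open>\<alpha> j\<close>, while the exchange turns the future weights \<open>\<beta> j\<close>
  into \<open>w\<close>. For \<open>j = k\<close> the exponent is 0, since the exchanged transition
  then starts at \<open>k\<close> itself.\<close>

lemma backward_replacement: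
  assumes k: "k \<le> j" "j < N" and h: "\<And>x. \<bar>h x\<bar> \<le> 1"
    and dh: "0 \<le> dh" "dh \<le> 1" "\<And>x z. dh \<le> Qh x z"
  shows "\<bar>(\<Sum>x\<in>UNIV. propagate Qh gh k (\<lambda>x. h x * \<alpha> k x) (j - k) x * \<beta> j x) / (\<Sum>x\<in>UNIV. \<alpha> j x * \<beta> j x)
         - (\<Sum>x\<in>UNIV. propagate Qh gh k (\<lambda>x. h x * \<alpha> k x) (Suc j - k) x * \<beta> (Suc j) x) /
             (\<Sum>x\<in>UNIV. \<alpha> (Suc j) x * \<beta> (Suc j) x)\<bar>
         \<le> 2 * (1 - dh) ^ (j - k) * err (Suc j)"
proof -
  define \<psi> where "\<psi> j = propagate Qh gh k (\<lambda>x. h x * \<alpha> k x) (j - k)" for j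
  define w where "w x = (\<Sum>z\<in>UNIV. Qh x z * (gh (Suc j) z * \<beta> (Suc j) z))" for x
  define T where "T = (\<Sum>x\<in>UNIV. \<alpha> j x)"
  have T: "0 < T" using pos_hat[of j] k by (simp add: T_def)
  have \<alpha>: "\<alpha> j = propagate Qh gh k (\<alpha> k) (j - k)"
    using propagate_add[of Qh gh 0 k _ "j - k"] k by (simp add: forward_def)
  obtain c where c: "\<And>x. \<bar>\<psi> j x - c * \<alpha> j x\<bar> \<le> (1 - dh) ^ (j - k) * \<alpha> j x"
    using propagate_contraction[of dh Qh gh "\<alpha> k" h k "j - k"] dh Qh gh \<alpha>_nonneg h
    unfolding \<alpha> \<psi>_def by blast
  have w_nonneg: "0 \<le> w x" for x
    unfolding w_def using Qh gh \<beta>_pos[of "Suc j"] k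
    by (intro sum_nonneg mult_nonneg_nonneg) (auto simp: less_imp_le)
  have step: "(\<Sum>x\<in>UNIV. a x * w x) = (\<Sum>x\<in>UNIV. (\<Sum>z\<in>UNIV. a z * Qh z x) * gh (Suc j) x * \<beta> (Suc j) x)" for a
    using propagate_backward[of Qh gh j a 1 "\<beta> (Suc j)"] by (simp add: w_def)
  have \<psi>w: "(\<Sum>x\<in>UNIV. \<psi> (Suc j) x * \<beta> (Suc j) x) = (\<Sum>x\<in>UNIV. w x * \<psi> j x)"
    using k by (simp add: mult.commute[of "w _"] step \<psi>_def Suc_diff_le)
  have \<alpha>w: "(\<Sum>x\<in>UNIV. \<alpha> (Suc j) x * \<beta> (Suc j) x) = (\<Sum>x\<in>UNIV. w x * \<alpha> j x)"
    by (simp add: mult.commute[of "w _"] step \<alpha>_Suc)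
  have w_pos: "0 < (\<Sum>x\<in>UNIV. w x * \<alpha> j x)"
    unfolding \<alpha>w[symmetric] using k \<beta>_pos by (intro sum_\<alpha>_pos) auto
  have \<beta>_pos': "0 < (\<Sum>x\<in>UNIV. \<beta> j x * \<alpha> j x)"
    using k \<beta>_pos sum_\<alpha>_pos[of j "\<beta> j"] by (simp add: mult.commute)
  \<comment> \<open>Only the true weights \<open>\<beta> j\<close> are bounded from below, so that
    \<open>d\<close> and not \<open>dh\<close> enters the error of an exchange.\<close>
  have den: "d * T * (\<Sum>x\<in>UNIV. g (Suc j) x * \<beta> (Suc j) x) \<le> (\<Sum>x\<in>UNIV. \<beta> j x * \<alpha> j x)"
  proof -
    have "d * (\<Sum>x\<in>UNIV. g (Suc j) x * \<beta> (Suc j) x) \<le> \<beta> j x" for x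
      unfolding \<beta>_step[OF k(2)] sum_distrib_left using Q g \<beta>_pos[of "Suc j"] k
      by (intro sum_mono mult_right_mono) (auto simp: less_imp_le)
    then have "(\<Sum>x\<in>UNIV. (d * (\<Sum>x\<in>UNIV. g (Suc j) x * \<beta> (Suc j) x)) * \<alpha> j x) \<le> (\<Sum>x\<in>UNIV. \<beta> j x * \<alpha> j x)"
      using \<alpha>_nonneg by (intro sum_mono mult_right_mono) auto
    then show ?thesis
      unfolding sum_distrib_left[symmetric] by (simp add: T_def mult_ac)
  qed
  have num: "(\<Sum>x\<in>UNIV. \<bar>\<beta> j x - w x\<bar> * \<alpha> j x)
      \<le> (\<Sum>z\<in>UNIV. T * (D * g (Suc j) z + \<bar>g (Suc j) z - gh (Suc j) z\<bar>) * \<beta> (Suc j) z)" (is "_ \<le> ?R")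
  proof -
    let ?S = "\<Sum>z\<in>UNIV. (D * g (Suc j) z + \<bar>g (Suc j) z - gh (Suc j) z\<bar>) * \<beta> (Suc j) z"
    have "\<bar>\<beta> j x - w x\<bar> \<le> ?S" for x
    proof -
      have "\<beta> j x - w x = (\<Sum>z\<in>UNIV. (Q x z * g (Suc j) z - Qh x z * gh (Suc j) z) * \<beta> (Suc j) z)"
        by (simp add: \<beta>_step[OF k(2)] w_def sum_subtractf algebra_simps)
      also have "\<bar>\<dots>\<bar> \<le> (\<Sum>z\<in>UNIV. \<bar>(Q x z * g (Suc j) z - Qh x z * gh (Suc j) z) * \<beta> (Suc j) z\<bar>)"
        by simp
      also have "\<dots> \<le> ?S"
      proof (rule sum_mono)
        fix z
        have "Q x z * g (Suc j) z - Qh x z * gh (Suc j) z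
            = (Q x z - Qh x z) * g (Suc j) z + Qh x z * (g (Suc j) z - gh (Suc j) z)"
          by (simp add: algebra_simps)
        also have "\<bar>\<dots>\<bar> \<le> \<bar>Q x z - Qh x z\<bar> * g (Suc j) z + Qh x z * \<bar>g (Suc j) z - gh (Suc j) z\<bar>"
          using abs_triangle_ineq[of "(Q x z - Qh x z) * g (Suc j) z" "Qh x z * (g (Suc j) z - gh (Suc j) z)"]
            g[of "Suc j" z] Qh(1)[of x z]
          by (simp add: abs_mult)
        also have "\<dots> \<le> D * g (Suc j) z + \<bar>g (Suc j) z - gh (Suc j) z\<bar>"
          using D g Qh by (intro add_mono mult_right_mono mult_left_le_one_le) auto
        finally show "\<bar>(Q x z * g (Suc j) z - Qh x z * gh (Suc j) z) * \<beta> (Suc j) z\<bar>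
            \<le> (D * g (Suc j) z + \<bar>g (Suc j) z - gh (Suc j) z\<bar>) * \<beta> (Suc j) z"
          using \<beta>_pos[of "Suc j" z] k by (simp add: abs_mult mult_right_mono)
      qed
      finally show ?thesis .
    qed
    then have "(\<Sum>x\<in>UNIV. \<bar>\<beta> j x - w x\<bar> * \<alpha> j x) \<le> (\<Sum>x\<in>UNIV. ?S * \<alpha> j x)"
      using \<alpha>_nonneg by (intro sum_mono mult_right_mono) auto
    also have "\<dots> = T * ?S"
      unfolding T_def sum_distrib_left[symmetric] by (rule mult.commute)
    also have "\<dots> = ?R"
      by (simp add: sum_distrib_left mult_ac)
    finally show ?thesis .
  qed
  have "(\<Sum>x\<in>UNIV. \<bar>\<beta> j x - w x\<bar> * \<alpha> j x) / (\<Sum>x\<in>UNIV. \<beta> j x * \<alpha> j x) \<le> err (Suc j)"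
    using relative_error[OF d(1) T D_nonneg(2) g pos[of "Suc j"] \<beta>_pos[of "Suc j"] \<beta>_ratio[of "Suc j"] num den] k
    by (simp add: err_def)
  moreover have "0 \<le> (1 - dh) ^ (j - k)" using dh by simp
  ultimately have "\<bar>(\<Sum>x\<in>UNIV. \<beta> j x * \<psi> j x) / (\<Sum>x\<in>UNIV. \<beta> j x * \<alpha> j x)
      - (\<Sum>x\<in>UNIV. w x * \<psi> j x) / (\<Sum>x\<in>UNIV. w x * \<alpha> j x)\<bar> \<le> 2 * (1 - dh) ^ (j - k) * err (Suc j)"
    using ratio_diff[of "\<alpha> j" "\<psi> j" c "(1 - dh) ^ (j - k)" w "\<beta> j"] \<alpha>_nonneg c w_nonneg w_pos \<beta>_pos'
    by (smt (verit, best) mult_left_mono)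
  then show ?thesis
    unfolding \<psi>_def[symmetric] \<psi>w \<alpha>w by (simp add: mult.commute)
qed

text \<open>Takes over at the ratio where \<open>forward_telescope\<close> stops for
  \<open>j = k\<close>: by then everything up to \<open>k\<close> is estimated, and the later times
  follow one by one.\<close>

lemma backward_telescope:
  assumes h: "\<And>x. \<bar>h x\<bar> \<le> 1" and dh: "0 \<le> dh" "dh \<le> 1" "\<And>x z. dh \<le> Qh x z" and "k + m \<le> N"
  shows "\<bar>(\<Sum>x\<in>UNIV. \<alpha> k x * (h x * \<beta> k x)) / (\<Sum>x\<in>UNIV. \<alpha> k x * \<beta> k x)
         - (\<Sum>x\<in>UNIV. propagate Qh gh k (\<lambda>x. h x * \<alpha> k x) m x * \<beta> (k + m) x) /
             (\<Sum>x\<in>UNIV. \<alpha> (k + m) x * \<beta> (k + m) x)\<bar>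
         \<le> (\<Sum>i<m. 2 * (1 - dh) ^ i * err (Suc (k + i)))"
  using assms(5)
proof (induction m)
  case 0
  then show ?case by (simp add: mult_ac)
next
  case (Suc m)
  have "Suc (k + m) - k = Suc m" by simp
  with Suc backward_replacement[of k "k + m" h dh] h dh show ?case
    by (simp del: propagate.simps)
qed

lemma \<beta>_N: "\<beta> N x = 1"
  by (simp add: \<beta>_def)

text \<open>The exchange is complete once the switching time reaches \<open>N\<close>, where
  \<open>\<beta>\<close> is 1; adjointness then brings the estimated posterior back to time
  \<open>k\<close>.\<close>

lemma smoothing_telescope:
  assumes k: "k \<le> N" and h: "\<And>x. \<bar>h x\<bar> \<le> 1"
    and dh: "0 \<le> dh" "dh \<le> 1" "\<And>x z. dh \<le> Qh x z"
  defines "b \<equiv> backward Qh gh (N - k) k (\<lambda>_. 1)"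
  shows "\<bar>(\<Sum>x\<in>UNIV. forward p Q g k x * (h x * \<beta> k x)) / (\<Sum>x\<in>UNIV. forward p Q g k x * \<beta> k x)
         - (\<Sum>x\<in>UNIV. \<alpha> k x * (h x * b x)) / (\<Sum>x\<in>UNIV. \<alpha> k x * b x)\<bar>
         \<le> (\<Sum>i\<le>k. 2 * (1 - d) ^ (k - i) * err i) + (\<Sum>i<N - k. 2 * (1 - dh) ^ i * err (Suc (k + i)))"
proof -
  have \<alpha>N: "\<alpha> N = propagate Qh gh k (\<alpha> k) (N - k)"
    using propagate_add[of Qh gh 0 k _ "N - k"] k by (simp add: forward_def)
  have "(\<Sum>x\<in>UNIV. \<alpha> N x * \<beta> N x) = (\<Sum>x\<in>UNIV. \<alpha> k x * b x)"
    using propagate_backward[of Qh gh k "\<alpha> k" "N - k" "\<lambda>_. 1"] by (simp add: b_def \<alpha>N \<beta>_N)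
  moreover have "(\<Sum>x\<in>UNIV. propagate Qh gh k (\<lambda>x. h x * \<alpha> k x) (N - k) x * \<beta> N x) = (\<Sum>x\<in>UNIV. \<alpha> k x * (h x * b x))"
    using propagate_backward[of Qh gh k "\<lambda>x. h x * \<alpha> k x" "N - k" "\<lambda>_. 1"] by (simp add: b_def \<beta>_N mult_ac)
  moreover have "(\<Sum>x\<in>UNIV. \<alpha> k x * backward Q g (k - k) k (\<lambda>x. h x * \<beta> k x) x) = (\<Sum>x\<in>UNIV. \<alpha> k x * (h x * \<beta> k x))"
    by simp
  ultimately show ?thesis
    using forward_telescope[of k h k] backward_telescope[of h dh k "N - k"] k h dh by simp
qed

end

subsection \<open>Perturbation of filtering and smoothing\<close>

text \<open>Rescaling the previous filter leaves the next one unchanged, so it suffices to normalise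
  once at the end. Each later denominator is the quotient of two successive total masses of
  \<open>F\<close>, which turns positive denominators into positive masses. Time
  \<open>Suc j\<close> of the filter is time \<open>j\<close> of \<open>F\<close>.\<close>

lemma filtering_eq_forward:
  assumes "\<And>i. i \<in> {1..Suc j} \<Longrightarrow> 0 < filtering_denom \<pi> Q f i y"
  defines "F \<equiv> forward (($) \<pi>) (\<lambda>x z. Q $ x $ z) (\<lambda>j x. f x (y (Suc j)))"
  shows "filtering \<pi> Q f (Suc j) y x = F j x / (\<Sum>x\<in>UNIV. F j x)" and "0 < (\<Sum>x\<in>UNIV. F j x)"
proof -
  have "(\<forall>x. filtering \<pi> Q f (Suc j) y x = F j x / (\<Sum>x\<in>UNIV. F j x)) \<and> 0 < (\<Sum>x\<in>UNIV. F j x)"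
    using assms(1)
  proof (induction j)
    case 0
    then show ?case
      using 0[of 1] by (auto simp: F_def forward_def filtering_denom_def)
  next
    case (Suc j)
    define S where "S = (\<Sum>x\<in>UNIV. F j x)"
    have IH: "filtering \<pi> Q f (Suc j) y z = F j z / S" "0 < S" for z
      using Suc by (auto simp: S_def)
    have F: "F (Suc j) x = (\<Sum>z\<in>UNIV. Q $ z $ x * f x (y (Suc (Suc j))) * F j z)" for x
      by (simp add: F_def forward_def sum_distrib_left mult_ac)
    have 1: "(\<Sum>z\<in>UNIV. Q $ z $ x * f x (y (Suc (Suc j))) * filtering \<pi> Q f (Suc j) y z) = F (Suc j) x / S" for x
      by (simp add: F IH sum_divide_distrib)
    have 2: "(\<Sum>z\<in>UNIV. \<Sum>x\<in>UNIV. Q $ z $ x * f x (y (Suc (Suc j))) * filtering \<pi> Q f (Suc j) y z)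
        = (\<Sum>x\<in>UNIV. F (Suc j) x) / S"
      by (subst sum.swap) (simp add: 1 sum_divide_distrib)
    have "0 < (\<Sum>x\<in>UNIV. F (Suc j) x) / S"
      using Suc.prems[of "Suc (Suc j)"] by (simp add: filtering_denom_def 2)
    then have "0 < (\<Sum>x\<in>UNIV. F (Suc j) x)"
      using IH(2) by (simp add: zero_less_divide_iff)
    then show ?case
      using IH(2) by (simp add: 1 2)
  qed
  then show "filtering \<pi> Q f (Suc j) y x = F j x / (\<Sum>x\<in>UNIV. F j x)" "0 < (\<Sum>x\<in>UNIV. F j x)"
    by auto
qed

text \<open>Downward induction on \<open>k\<close>: the predictor in the denominator reappears as a
  factor of \<open>F (Suc k)\<close> and cancels, leaving one step of \<open>B\<close>. Positive
  entries of \<open>Q\<close> keep the predictor positive. They are requested for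
  \<open>k < N\<close>, so that the filtering case \<open>k = N\<close> admits matrices with
  zeros.\<close>

lemma smoothing_eq_backward:
  fixes Q :: "real^'k^'k::finite"
  assumes den: "\<And>i. i \<in> {1..Suc N} \<Longrightarrow> 0 < filtering_denom \<pi> Q f i y"
    and \<pi>: "\<And>x. 0 \<le> \<pi> $ x" and f: "\<And>j x. 0 \<le> f x (y (Suc j))" and Q0: "\<And>x z. 0 \<le> Q $ x $ z"
    and Q: "\<And>x z. k < N \<Longrightarrow> 0 < Q $ x $ z" and k: "k \<le> N"
  defines "F \<equiv> forward (($) \<pi>) (\<lambda>x z. Q $ x $ z) (\<lambda>j x. f x (y (Suc j)))"
    and "B \<equiv> \<lambda>k. backward (\<lambda>x z. Q $ x $ z) (\<lambda>j x. f x (y (Suc j))) (N - k) k (\<lambda>_. 1)"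
  shows "smoothing \<pi> Q f (Suc N) (Suc k) y x = F k x * B k x / (\<Sum>x\<in>UNIV. F k x * B k x)"
  using k Q
proof (induction "N - k" arbitrary: k x)
  case 0
  then have "k = N" by simp
  then show ?case
    using filtering_eq_forward(1)[of N \<pi> Q f y x] den
    by (subst smoothing.simps) (simp add: F_def B_def)
next
  case (Suc m)
  then have k: "k < N" by simp
  define S where "S = (\<Sum>x\<in>UNIV. F k x)"
  have S: "0 < S" and flt: "filtering \<pi> Q f (Suc k) y z = F k z / S" for z
    using filtering_eq_forward[of k \<pi> Q f y] den k by (auto simp: S_def F_def)
  have F_nonneg: "0 \<le> F k z" for z
    unfolding F_def forward_def using \<pi> f Q0 by (intro propagate_nonneg) auto
  obtain z0 where "F k z0 \<noteq> 0"
    using S unfolding S_def by (metis less_irrefl sum.neutral)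
  then have P: "0 < (\<Sum>z\<in>UNIV. Q $ z $ x' * F k z)" for x'
    using F_nonneg[of z0] F_nonneg Suc.prems(2) k
    by (intro sum_pos2[of _ z0]) (auto simp: less_imp_le less_le)
  define Z where "Z = (\<Sum>x\<in>UNIV. F (Suc k) x * B (Suc k) x)"
  have FS: "F (Suc k) x' = (\<Sum>z\<in>UNIV. Q $ z $ x' * F k z) * f x' (y (Suc (Suc k)))" for x'
    by (simp add: F_def forward_def mult.commute)
  have BS: "B k x = (\<Sum>z\<in>UNIV. Q $ x $ z * (f z (y (Suc (Suc k))) * B (Suc k) z))" for x
    using k by (simp add: B_def Suc_diff_Suc[symmetric])
  have Z: "(\<Sum>x\<in>UNIV. F k x * B k x) = Z"
    unfolding Z_def FS BS sum_distrib_left sum_distrib_right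
    by (subst sum.swap) (simp add: mult_ac)
  have IH: "smoothing \<pi> Q f (Suc N) (Suc (Suc k)) y x' = F (Suc k) x' * B (Suc k) x' / Z" for x'
    unfolding Z_def using Suc k by (intro Suc.hyps(1)) auto
  have "smoothing \<pi> Q f (Suc N) (Suc k) y x =
      (\<Sum>x'\<in>UNIV. Q $ x $ x' * (F k x / S) / (\<Sum>z\<in>UNIV. Q $ z $ x' * (F k z / S)) *
          (F (Suc k) x' * B (Suc k) x' / Z))"
    using k by (subst smoothing.simps) (simp add: flt IH)
  also have "\<dots> = (\<Sum>x'\<in>UNIV. F k x * (Q $ x $ x' * (f x' (y (Suc (Suc k))) * B (Suc k) x')) / Z)"
  proof (rule sum.cong[OF refl])
    fix x'
    have "(\<Sum>z\<in>UNIV. Q $ z $ x' * (F k z / S)) = (\<Sum>z\<in>UNIV. Q $ z $ x' * F k z) / S"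
      by (simp add: sum_divide_distrib)
    then show "Q $ x $ x' * (F k x / S) / (\<Sum>z\<in>UNIV. Q $ z $ x' * (F k z / S)) * (F (Suc k) x' * B (Suc k) x' / Z)
        = F k x * (Q $ x $ x' * (f x' (y (Suc (Suc k))) * B (Suc k) x')) / Z"
      using P[of x'] S by (simp add: FS)
  qed
  also have "\<dots> = F k x * B k x / Z"
    by (simp add: BS sum_distrib_left sum_divide_distrib)
  finally show ?case by (simp add: Z)
qed

text \<open>The sign of the difference is the extremal test function. The exchanges can thus be
  followed through the mean of one bounded \<open>h\<close> at a time.\<close>

lemma tv_dist_le:
  assumes "\<And>h. (\<And>x. \<bar>h x\<bar> \<le> 1) \<Longrightarrow> \<bar>(\<Sum>x\<in>UNIV. h x * \<mu> x) - (\<Sum>x\<in>UNIV. h x * \<nu> x)\<bar> \<le> b"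
  shows "tv_dist \<mu> \<nu> \<le> b"
proof -
  have "tv_dist \<mu> \<nu> = (\<Sum>x\<in>UNIV. sgn (\<mu> x - \<nu> x) * \<mu> x) - (\<Sum>x\<in>UNIV. sgn (\<mu> x - \<nu> x) * \<nu> x)"
    unfolding sum_subtractf[symmetric] right_diff_distrib[symmetric] tv_dist_def
    by (simp add: abs_sgn mult.commute)
  also have "\<dots> \<le> b"
    using assms[of "\<lambda>x. sgn (\<mu> x - \<nu> x)"] by (simp add: abs_sgn_eq)
  finally show ?thesis .
qed

definition rel_err :: "('k::finite \<Rightarrow> 'y \<Rightarrow> real) \<Rightarrow> ('k \<Rightarrow> 'y \<Rightarrow> real) \<Rightarrow> 'y \<Rightarrow> real" where
  "rel_err f fh y = (\<Sum>x\<in>UNIV. \<bar>f x y - fh x y\<bar>) / (\<Sum>x\<in>UNIV. f x y)"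

text \<open>A replacement of parameters at a time \<open>l \<le> k\<close> is forgotten at the mixing rate of the true
  forward chain, one at a time \<open>l > k\<close> at that of the estimated backward chain.\<close>

definition geo_weight :: "real \<Rightarrow> real \<Rightarrow> nat \<Rightarrow> nat \<Rightarrow> real" where
  "geo_weight d dh k l = (if l \<le> k then 2 * (1 - d) ^ (k - l) else 2 * (1 - dh) ^ (l - Suc k))"

text \<open>For \<open>n = k\<close> smoothing is filtering, so this one bound covers both
  recursions; the positivity of \<open>dh\<close> is tied to \<open>k < n\<close> for that
  reason.\<close>

lemma smoothing_perturbation:
  fixes Q Qh :: "real^'k^'k::finite"
  assumes d: "0 < d" "d \<le> 1" and dh: "0 \<le> dh" "dh \<le> 1" "\<And>x z. dh \<le> Qh $ x $ z" "k < n \<Longrightarrow> 0 < dh"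
    and \<pi>: "prob_vector \<pi>" "\<And>x. d \<le> \<pi> $ x" and \<pi>h: "prob_vector \<pi>h"
    and Q: "transition_matrix Q" "\<And>x z. d \<le> Q $ x $ z" and Qh: "transition_matrix Qh"
    and f: "\<And>j x. 1 \<le> j \<Longrightarrow> 0 \<le> f x (y j)" and fh: "\<And>j x. 1 \<le> j \<Longrightarrow> 0 \<le> fh x (y j)"
    and pos: "\<And>j. j \<in> {1..n} \<Longrightarrow> 0 < (\<Sum>x\<in>UNIV. f x (y j))"
    and den: "\<And>j. j \<in> {1..n} \<Longrightarrow> 0 < filtering_denom \<pi>h Qh fh j y"
    and k: "k \<in> {1..n}"
  shows "tv_dist (smoothing \<pi> Q f n k y) (smoothing \<pi>h Qh fh n k y)
      \<le> (\<Sum>l\<in>{1..n}. geo_weight d dh k l *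
            ((if l = 1 then norm (\<pi> - \<pi>h) else norm (Q - Qh)) / d + rel_err f fh (y l) / d\<^sup>2))"
proof -
  obtain N j where N: "n = Suc N" and j: "k = Suc j" "j \<le> N"
    using k by (cases n; cases k) auto
  have prob_le1: "v $ x \<le> 1" if "prob_vector v" for v :: "real^'k" and x
  proof -
    have "v $ x \<le> (\<Sum>x\<in>UNIV. v $ x)"
      using that by (intro member_le_sum) (auto simp: prob_vector_def)
    then show ?thesis using that by (simp add: prob_vector_def)
  qed
  have Qb: "0 \<le> Q $ x $ z" "Q $ x $ z \<le> 1" "0 \<le> Qh $ x $ z" "Qh $ x $ z \<le> 1" for x z
    using Q(1) Qh prob_le1 unfolding transition_matrix_def by (auto simp: prob_vector_def)
  \<comment> \<open>The true recursion has positive denominators of its own accord: the entries of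
    \<open>\<pi>\<close> and \<open>Q\<close> are at least \<open>d\<close>, and at each observation
    some likelihood is positive.\<close>
  have fden: "0 < filtering_denom \<pi> Q f i y" if "i \<in> {1..n}" for i
    using that
  proof (induction i rule: less_induct)
    case (less i)
    obtain z where z: "f z (y i) \<noteq> 0"
      using pos[OF less.prems] by (metis less_irrefl sum.neutral)
    then have z0: "0 < f z (y i)" using f[of i z] less.prems by simp
    show ?case
    proof (cases "i = 1")
      case True
      then show ?thesis
        using z0 \<pi> d(1) f[of i] unfolding filtering_denom_def
        by (auto intro!: sum_pos2[of _ z] mult_pos_pos mult_nonneg_nonneg simp: prob_vector_def intro: less_le_trans)
    next
      case False
      then obtain m where m: "i = Suc (Suc m)" using less.prems by (cases i; cases "i - 1") auto
      let ?F = "forward (($) \<pi>) (\<lambda>x z. Q $ x $ z) (\<lambda>j x. f x (y (Suc j))) m"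
      have F: "filtering \<pi> Q f (Suc m) y x = ?F x / sum ?F UNIV" "0 < sum ?F UNIV" for x
        using filtering_eq_forward[of m \<pi> Q f y] less m by auto
      have F0: "0 \<le> ?F x" for x
        unfolding forward_def using \<pi>(1) f Qb by (intro propagate_nonneg) (auto simp: prob_vector_def)
      obtain w where w: "?F w \<noteq> 0" using F(2) by (metis less_irrefl sum.neutral)
      have w0: "0 < filtering \<pi> Q f (Suc m) y w"
        using F0[of w] w F by (simp add: less_le)
      have p0: "0 \<le> filtering \<pi> Q f (Suc m) y x" for x
        using F0[of x] F by (simp add: less_imp_le)
      have "0 < (\<Sum>x'\<in>UNIV. \<Sum>x''\<in>UNIV. Q $ x' $ x'' * f x'' (y i) * filtering \<pi> Q f (Suc m) y x')"
        using w0 p0 z0 f[of i] m Qb less_le_trans[OF d(1) Q(2)]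
        by (intro sum_pos2[of _ w] sum_pos2[of _ z] sum_nonneg mult_nonneg_nonneg mult_pos_pos) auto
      then show ?thesis using m by (simp add: filtering_denom_def)
    qed
  qed
  define g where "g i x = f x (y (Suc i))" for i x
  define gh where "gh i x = fh x (y (Suc i))" for i x
  interpret R: perturbed_recursions "($) \<pi>" "($) \<pi>h" "\<lambda>x z. Q $ x $ z" "\<lambda>x z. Qh $ x $ z" g gh d
    "norm (\<pi> - \<pi>h)" "norm (Q - Qh)" N
  proof
    show "\<bar>\<pi> $ x - \<pi>h $ x\<bar> \<le> norm (\<pi> - \<pi>h)" for x
      using component_le_norm_cart[of "\<pi> - \<pi>h" x] by simp
    show "\<bar>Q $ x $ z - Qh $ x $ z\<bar> \<le> norm (Q - Qh)" for x z
      using component_le_norm_cart[of "(Q - Qh) $ x" z] Finite_Cartesian_Product.norm_nth_le[of "Q - Qh" x] by simp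
    show "0 < (\<Sum>x\<in>UNIV. forward (($) \<pi>h) (\<lambda>x z. Qh $ x $ z) gh i x)" if "i \<le> N" for i
      using filtering_eq_forward(2)[of i \<pi>h Qh fh y] den that N by (simp add: gh_def[abs_def])
    show "0 \<le> \<pi>h $ x" "\<pi>h $ x \<le> 1" for x
      using \<pi>h prob_le1 by (auto simp: prob_vector_def)
    show "0 < (\<Sum>x\<in>UNIV. g i x)" if "i \<le> N" for i
      using pos[of "Suc i"] that N by (simp add: g_def)
  qed (use d \<pi> Q Qb f fh in \<open>auto simp: g_def gh_def\<close>)
  define b where "b = backward (\<lambda>x z. Qh $ x $ z) gh (N - j) j (\<lambda>_. 1)"
  define F where "F = forward (($) \<pi>) (\<lambda>x z. Q $ x $ z) g"
  have s1: "smoothing \<pi> Q f n k y x = F j x * R.\<beta> j x / (\<Sum>x\<in>UNIV. F j x * R.\<beta> j x)" for x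
    unfolding N j(1) F_def R.\<beta>_def g_def
    by (rule smoothing_eq_backward)
      (use fden N \<pi>(1) f Qb j less_le_trans[OF d(1) Q(2)] in \<open>auto simp: prob_vector_def\<close>)
  have s2: "smoothing \<pi>h Qh fh n k y x = R.\<alpha> j x * b x / (\<Sum>x\<in>UNIV. R.\<alpha> j x * b x)" for x
    unfolding N j(1) b_def gh_def
    by (rule smoothing_eq_backward)
      (use den N j \<pi>h fh Qb less_le_trans[OF dh(4,3)] in \<open>auto simp: prob_vector_def\<close>)
  have "tv_dist (smoothing \<pi> Q f n k y) (smoothing \<pi>h Qh fh n k y)
      \<le> (\<Sum>i\<le>j. 2 * (1 - d) ^ (j - i) * R.err i) + (\<Sum>i<N - j. 2 * (1 - dh) ^ i * R.err (Suc (j + i)))"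
  proof (rule tv_dist_le)
    fix h :: "'k \<Rightarrow> real" assume h: "\<And>x. \<bar>h x\<bar> \<le> 1"
    have "(\<Sum>x\<in>UNIV. h x * smoothing \<pi> Q f n k y x) = (\<Sum>x\<in>UNIV. F j x * (h x * R.\<beta> j x)) / (\<Sum>x\<in>UNIV. F j x * R.\<beta> j x)"
      by (simp add: s1 sum_divide_distrib mult_ac)
    moreover have "(\<Sum>x\<in>UNIV. h x * smoothing \<pi>h Qh fh n k y x) = (\<Sum>x\<in>UNIV. R.\<alpha> j x * (h x * b x)) / (\<Sum>x\<in>UNIV. R.\<alpha> j x * b x)"
      by (simp add: s2 sum_divide_distrib mult_ac)
    ultimately show "\<bar>(\<Sum>x\<in>UNIV. h x * smoothing \<pi> Q f n k y x) - (\<Sum>x\<in>UNIV. h x * smoothing \<pi>h Qh fh n k y x)\<bar>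
        \<le> (\<Sum>i\<le>j. 2 * (1 - d) ^ (j - i) * R.err i) + (\<Sum>i<N - j. 2 * (1 - dh) ^ i * R.err (Suc (j + i)))"
      using R.smoothing_telescope[OF j(2) h dh(1-3)] by (simp add: b_def F_def)
  qed
  \<comment> \<open>Both decay rates merge into \<open>geo_weight\<close>; \<open>Suc\<close>
    converts the count of times from 0 into the count from 1.\<close>
  also have "\<dots> = (\<Sum>i\<le>j. geo_weight d dh k (Suc i) * R.err i) + (\<Sum>i\<in>{Suc j..<Suc N}. geo_weight d dh k (Suc i) * R.err i)"
  proof -
    have "(\<Sum>i\<in>{Suc j..<Suc N}. geo_weight d dh k (Suc i) * R.err i)
        = (\<Sum>i\<in>{0..<N - j}. geo_weight d dh k (Suc (i + Suc j)) * R.err (i + Suc j))"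
      using sum.shift_bounds_nat_ivl[of "\<lambda>i. geo_weight d dh k (Suc i) * R.err i" 0 "Suc j" "N - j"] j(2)
      by (simp add: Suc_diff_le)
    then show ?thesis
      by (auto simp: geo_weight_def j(1) add_ac atLeast0LessThan)
  qed
  also have "\<dots> = (\<Sum>i<Suc N. geo_weight d dh k (Suc i) * R.err i)"
    using sum.atLeastLessThan_concat[of 0 "Suc j" "Suc N" "\<lambda>i. geo_weight d dh k (Suc i) * R.err i"] j(2)
    by (simp add: atLeast0LessThan lessThan_Suc_atMost del: sum.lessThan_Suc sum.op_ivl_Suc)
  also have "\<dots> = (\<Sum>l\<in>{1..n}. geo_weight d dh k l * R.err (l - 1))"
    unfolding N by (rule sum.reindex_bij_witness[of _ "\<lambda>l. l - 1" Suc]) auto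
  also have "\<dots> = (\<Sum>l\<in>{1..n}. geo_weight d dh k l *
            ((if l = 1 then norm (\<pi> - \<pi>h) else norm (Q - Qh)) / d + rel_err f fh (y l) / d\<^sup>2))"
    by (intro sum.cong refl) (auto simp: R.err_def rel_err_def g_def gh_def)
  finally show ?thesis .
qed

section \<open>Total geometric weight\<close>

lemma sum_twice_power_le:
  fixes e :: real
  assumes "0 < e" "e \<le> 1"
  shows "(\<Sum>i<m. 2 * (1 - e) ^ i) \<le> 2 / e"
proof -
  have "(\<Sum>i<m. (1 - e) ^ i) = (1 - (1 - e) ^ m) / e"
    using assms by (subst sum_gp_strict) simp
  also have "\<dots> \<le> 1 / e"
    using assms by (intro divide_right_mono) auto
  finally show ?thesis
    by (simp add: sum_distrib_left[symmetric])
qed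

lemma sum_geo_weight_forward:
  assumes "0 < d" "d \<le> 1"
  shows "(\<Sum>l\<in>{1..k}. geo_weight d dh k l) \<le> 2 / d"
proof -
  have "(\<Sum>l\<in>{1..k}. geo_weight d dh k l) = (\<Sum>i<k. 2 * (1 - d) ^ i)"
    by (rule sum.reindex_bij_witness[of _ "\<lambda>i. k - i" "\<lambda>i. k - i"]) (auto simp: geo_weight_def)
  with sum_twice_power_le[OF assms] show ?thesis by simp
qed

lemma sum_geo_weight:
  assumes d: "0 < d" "d \<le> 1" and dh: "0 < dh" "dh \<le> 1" and k: "k \<le> n"
  shows "(\<Sum>l\<in>{1..n}. geo_weight d dh k l) \<le> 2 / d + 2 / dh"
proof -
  have "(\<Sum>l\<in>{Suc k..n}. geo_weight d dh k l) = (\<Sum>i<n - k. 2 * (1 - dh) ^ i)"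
    by (rule sum.reindex_bij_witness[of _ "\<lambda>i. i + Suc k" "\<lambda>i. i - Suc k"]) (auto simp: geo_weight_def)
  moreover have "{1..n} = {1..k} \<union> {Suc k..n}" using k by auto
  then have "(\<Sum>l\<in>{1..n}. geo_weight d dh k l)
      = (\<Sum>l\<in>{1..k}. geo_weight d dh k l) + (\<Sum>l\<in>{Suc k..n}. geo_weight d dh k l)"
    by (simp only:) (rule sum.union_disjoint; auto)
  ultimately show ?thesis
    using sum_geo_weight_forward[OF d, of dh k] sum_twice_power_le[OF dh, of "n - k"] by simp
qed

subsection \<open>Joint law of past and future observations\<close>

text \<open>On the event \<open>X j = x\<close> the observation at \<open>j\<close> has density
  \<open>f x\<close> and is independent of the first \<open>p\<close> ones. An exact formula would
  weight \<open>f x\<close> by the probability of this event given the past; bounding that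
  probability by 1 leaves a density free of the hidden chain.\<close>

lemma nn_integral_hidden_markov_le:
  fixes M :: "'w measure" and f :: "'k::finite \<Rightarrow> real^'d::finite \<Rightarrow> real"
  assumes hmm: "hidden_markov_model M \<Y> \<pi> Q f X Y" and j: "p < j"
    and G[measurable]: "G \<in> borel_measurable (PiM {1..p} (\<lambda>_. leb \<Y>) \<Otimes>\<^sub>M leb \<Y>)"
  defines "U \<equiv> \<lambda>\<omega>. \<lambda>i\<in>{1..p}. Y i \<omega>"
  shows "(\<integral>\<^sup>+\<omega>. G (U \<omega>, Y j \<omega>) \<partial>M) \<le> (\<integral>\<^sup>+\<omega>. \<integral>\<^sup>+y. ennreal (\<Sum>x\<in>UNIV. f x y) * G (U \<omega>, y) \<partial>leb \<Y> \<partial>M)"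
proof -
  interpret prob_space M using hmm by (simp add: hidden_markov_model_def)
  define L where "L = leb \<Y>"
  define P where "P = PiM {1..p} (\<lambda>_. L)"
  define F where "F = chain_algebra M X"
  note G' = G[folded L_def, folded P_def]
  note [measurable] = G'
  have X[measurable]: "i \<ge> 1 \<Longrightarrow> X i \<in> measurable M (count_space UNIV)" for i
    using hmm by (simp add: hidden_markov_model_def markov_chain_def)
  have Y[measurable]: "i \<ge> 1 \<Longrightarrow> Y i \<in> measurable M L" for i
    using hmm by (simp add: hidden_markov_model_def L_def)
  have Yj[measurable]: "Y j \<in> measurable M L" and Xj[measurable]: "X j \<in> measurable M (count_space UNIV)"
    using j X[of j] Y[of j] by simp_all
  have U[measurable]: "U \<in> measurable M P"
    unfolding U_def P_def by (intro measurable_restrict Y) simp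
  have dens: "f x \<in> borel_measurable L" "\<And>y. y \<in> space L \<Longrightarrow> 0 \<le> f x y" "(\<integral>\<^sup>+y. ennreal (f x y) \<partial>L) = 1" for x
    using hmm by (auto simp: hidden_markov_model_def prob_density_on_def L_def leb_def space_restrict_space)
  note [measurable] = dens(1)
  define \<nu> where "\<nu> x = density L (\<lambda>y. ennreal (f x y))" for x
  have \<nu>_prob: "prob_space (\<nu> x)" for x
    unfolding \<nu>_def by (rule prob_spaceI) (simp add: emeasure_density dens cong: nn_integral_cong)
  have sets_\<nu>[measurable_cong]: "sets (\<nu> x) = sets L" for x by (simp add: \<nu>_def)
  have sub: "subalgebra M F"
  proof -
    have "(\<lambda>\<omega>. \<lambda>i\<in>{1..}. X i \<omega>) \<in> measurable M (PiM {1..} (\<lambda>_. count_space UNIV))"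
      by (intro measurable_restrict X) simp
    then show ?thesis
      unfolding subalgebra_def F_def chain_algebra_def by (simp add: sets_image_in_sets)
  qed
  interpret F: finite_measure_subalgebra M F
    using sub by unfold_locales
  have XF: "X i \<in> measurable F (count_space UNIV)" if "i \<ge> 1" for i
  proof -
    have "(\<lambda>\<omega>. \<lambda>i\<in>{1..}. X i \<omega>) \<in> measurable F (PiM {1..} (\<lambda>_. count_space UNIV))"
      unfolding F_def chain_algebra_def
      by (intro measurable_vimage_algebra1) (auto simp: space_PiM)
    then have "(\<lambda>\<omega>. (\<lambda>i\<in>{1..}. X i \<omega>) i) \<in> measurable F (count_space UNIV)"
      by (rule measurable_compose) (use that in \<open>auto intro: measurable_component_singleton\<close>)
    then show ?thesis using that by simp
  qed
  define E where "E x = {\<omega> \<in> space M. X j \<omega> = x}" for x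
  have EF: "E x \<in> sets F" for x
  proof -
    have "X j -` {x} \<inter> space F \<in> sets F"
      using XF[of j] j by (intro measurable_sets) auto
    also have "X j -` {x} \<inter> space F = E x"
      using sub by (auto simp: E_def subalgebra_def)
    finally show ?thesis .
  qed
  then have E[measurable]: "E x \<in> sets M" for x
    using sub by (auto simp: subalgebra_def)
  have joint: "measure M (E x \<inter> {\<omega> \<in> space M. (\<forall>i\<in>{1..p}. Y i \<omega> \<in> A i) \<and> Y j \<omega> \<in> B})
      = measure M (E x \<inter> {\<omega> \<in> space M. \<forall>i\<in>{1..p}. Y i \<omega> \<in> A i}) * measure (\<nu> x) B"
    if A: "\<And>i. i \<in> {1..p} \<Longrightarrow> A i \<in> sets L" and B: "B \<in> sets L" for A B x
  proof -
    \<comment> \<open>With \<open>B\<close> placed at the index \<open>j\<close>, which exceeds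
      \<open>p\<close>, one family of sets describes both the past alone and the past together with
      \<open>Y j\<close>.\<close>
    define A' where "A' = A(j := B)"
    define S where "S J = {\<omega> \<in> space M. \<forall>i\<in>J. Y i \<omega> \<in> A' i}" for J
    have A': "i \<in> insert j {1..p} \<Longrightarrow> A' i \<in> sets L" for i
      using A B by (auto simp: A'_def)
    have S_meas: "S J \<in> sets M" if "J \<subseteq> insert j {1..p}" for J
    proof -
      have fin: "finite J" using that by (rule finite_subset) simp
      have "{\<omega> \<in> space M. Y i \<omega> \<in> A' i} \<in> sets M" if "i \<in> J" for i
      proof -
        have "Y i -` A' i \<inter> space M \<in> sets M"
          using that \<open>J \<subseteq> _\<close> A' j by (intro measurable_sets[OF Y]) auto
        also have "Y i -` A' i \<inter> space M = {\<omega> \<in> space M. Y i \<omega> \<in> A' i}" by auto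
        finally show ?thesis .
      qed
      then show ?thesis
        unfolding S_def using fin by (rule sets.sets_Collect_finite_All)
    qed
    have prod: "AE \<omega> in M. real_cond_exp M F (indicator (S J)) \<omega> =
        (\<Prod>i\<in>J. real_cond_exp M F (indicator {\<omega> \<in> space M. Y i \<omega> \<in> A' i}) \<omega>)"
      if "J \<subseteq> insert j {1..p}" for J
    proof -
      have "finite J" "J \<subseteq> {1..}" "\<forall>i\<in>J. A' i \<in> sets (leb \<Y>)"
        using that j A' finite_subset[OF that] by (auto simp: L_def)
      then show ?thesis
        using hmm unfolding hidden_markov_model_def F_def S_def by blast
    qed
    have marg: "AE \<omega> in M. real_cond_exp M F (indicator {\<omega> \<in> space M. Y j \<omega> \<in> A' j}) \<omega> = measure (\<nu> (X j \<omega>)) B"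
      using hmm j B unfolding hidden_markov_model_def F_def \<nu>_def L_def A'_def by auto
    \<comment> \<open>The product formulas with and without \<open>j\<close> differ by one factor,
      which depends on the chain through \<open>X j\<close> only. It is constant on
      \<open>E x\<close>, an event of the chain, so integrating over \<open>E x\<close> gives the
      factorisation.\<close>
    have "AE \<omega> in M. real_cond_exp M F (indicator (S (insert j {1..p}))) \<omega>
        = measure (\<nu> (X j \<omega>)) B * real_cond_exp M F (indicator (S {1..p})) \<omega>"
      using prod[OF order_refl] prod[OF subset_insertI] marg
      by eventually_elim (use j in simp)
    then have AE: "AE \<omega> in M. indicator (E x) \<omega> * real_cond_exp M F (indicator (S (insert j {1..p}))) \<omega>
        = measure (\<nu> x) B * (indicator (E x) \<omega> * real_cond_exp M F (indicator (S {1..p})) \<omega>)"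
      by eventually_elim (auto simp: E_def split: split_indicator)
    have int: "measure M (E x \<inter> S J) = (\<integral>\<omega>. indicator (E x) \<omega> * real_cond_exp M F (indicator (S J)) \<omega> \<partial>M)"
      if "J \<subseteq> insert j {1..p}" for J
    proof -
      note [measurable] = S_meas[OF that]
      have "measure M (E x \<inter> S J) = (\<integral>\<omega>\<in>E x. indicator (S J) \<omega> \<partial>M)"
        by (simp add: set_lebesgue_integral_def indicator_inter_arith[symmetric])
      also have "\<dots> = (\<integral>\<omega>\<in>E x. real_cond_exp M F (indicator (S J)) \<omega> \<partial>M)"
        using EF by (intro F.real_cond_exp_intA) (auto simp: emeasure_eq_measure)
      finally show ?thesis
        by (simp add: set_lebesgue_integral_def)
    qed
    have "measure M (E x \<inter> S (insert j {1..p})) = measure (\<nu> x) B * measure M (E x \<inter> S {1..p})"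
      unfolding int[OF order_refl] int[OF subset_insertI] integral_mult_right_zero[symmetric]
      by (rule integral_cong_AE) (use AE in simp_all)
    moreover have "S {1..p} = {\<omega> \<in> space M. \<forall>i\<in>{1..p}. Y i \<omega> \<in> A i}"
      "S (insert j {1..p}) = {\<omega> \<in> space M. (\<forall>i\<in>{1..p}. Y i \<omega> \<in> A i) \<and> Y j \<omega> \<in> B}"
      using j by (auto simp: S_def A'_def)
    ultimately show ?thesis by simp
  qed
  \<comment> \<open>An inequality between measures does not extend from rectangles to the product
     sigma-algebra; the factorisation on each event \<open>X j = x\<close> is an equality, which does.\<close>
  define N where "N x = density M (indicator (E x))" for x
  have sets_N[measurable_cong]: "sets (N x) = sets M" for x by (simp add: N_def)
  have emeasure_N: "emeasure (N x) A = emeasure M (E x \<inter> A)" if "A \<in> sets M" for A x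
    using that by (simp add: N_def emeasure_restricted)
  have pair: "distr (N x) P U \<Otimes>\<^sub>M \<nu> x = distr (N x) (P \<Otimes>\<^sub>M L) (\<lambda>\<omega>. (U \<omega>, Y j \<omega>))" for x
  proof (rule pair_measure_eqI)
    have "finite_measure (N x)"
      by (rule finite_measureI) (simp add: emeasure_N sets_eq_imp_space_eq[OF sets_N] emeasure_eq_measure)
    then show "sigma_finite_measure (distr (N x) P U)"
      by (intro finite_measure.axioms(1) finite_measure.finite_measure_distr) simp_all
    show "sigma_finite_measure (\<nu> x)"
      using \<nu>_prob by (rule prob_space_imp_sigma_finite)
    show "sets (distr (N x) P U \<Otimes>\<^sub>M \<nu> x) = sets (distr (N x) (P \<Otimes>\<^sub>M L) (\<lambda>\<omega>. (U \<omega>, Y j \<omega>)))"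
      by (simp cong: sets_pair_measure_cong add: sets_\<nu>)
    fix A B assume "A \<in> sets (distr (N x) P U)" and "B \<in> sets (\<nu> x)"
    then have A: "A \<in> sets P" and B[measurable]: "B \<in> sets L" by (simp_all add: sets_\<nu>)
    define C where "C = Y j -` B \<inter> space M"
    have C[measurable]: "C \<in> sets M" unfolding C_def by (intro measurable_sets[OF Yj B])
    \<comment> \<open>The law of the pair has to be checked on \<open>A \<times> B\<close> for every
      measurable \<open>A\<close>, but \<open>joint\<close> speaks of boxes. For fixed
      \<open>B\<close> both sides are finite measures in \<open>A\<close>, and these are determined
      by boxes.\<close>
    have "scale_measure (emeasure (\<nu> x) B) (distr (N x) P U) = distr (density M (indicator (E x \<inter> C))) P U"
    proof (rule measure_eqI_PiM_finite[where I = "{1..p}" and M = "\<lambda>_. L" and A = "\<lambda>_. space P"])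
      fix A assume A: "\<And>i. i \<in> {1..p} \<Longrightarrow> A i \<in> sets L"
      define T where "T = {\<omega> \<in> space M. \<forall>i\<in>{1..p}. Y i \<omega> \<in> A i}"
      have U_A: "U -` PiE {1..p} A \<inter> space M = T"
        by (auto simp: U_def T_def Pi_iff)
      have PA: "PiE {1..p} A \<in> sets P"
        unfolding P_def using A by (intro sets_PiM_I_finite) auto
      have T: "T \<in> sets M"
        unfolding U_A[symmetric] by (intro measurable_sets[OF U PA])
      have eq: "E x \<inter> C \<inter> T = E x \<inter> {\<omega> \<in> space M. (\<forall>i\<in>{1..p}. Y i \<omega> \<in> A i) \<and> Y j \<omega> \<in> B}"
        by (auto simp: C_def T_def)
      have "measure M (E x \<inter> C \<inter> T) = measure M (E x \<inter> T) * measure (\<nu> x) B"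
        unfolding eq unfolding T_def by (rule joint[OF A B])
      then have "emeasure (\<nu> x) B * emeasure M (E x \<inter> T) = emeasure M (E x \<inter> C \<inter> T)"
        using finite_measure.emeasure_eq_measure[OF prob_space.finite_measure[OF \<nu>_prob[of x]], of B]
        by (simp add: emeasure_eq_measure ennreal_mult'' mult.commute)
      then show "emeasure (scale_measure (emeasure (\<nu> x) B) (distr (N x) P U)) (PiE {1..p} A)
          = emeasure (distr (density M (indicator (E x \<inter> C))) P U) (PiE {1..p} A)"
        using PA T by (simp add: emeasure_distr U_A[unfolded One_nat_def] sets_eq_imp_space_eq[OF sets_N] emeasure_N
            emeasure_restricted)
    next
      have "space P = PiE {1..p} (\<lambda>_. space L)" by (simp add: P_def space_PiM)
      then show "range (\<lambda>_::nat. space P) \<subseteq> prod_algebra {1..p} (\<lambda>_. L)"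
        by (auto intro!: prod_algebraI_finite)
      show "emeasure (scale_measure (emeasure (\<nu> x) B) (distr (N x) P U)) (space P) \<noteq> \<infinity>" for i :: nat
        using finite_measure.emeasure_eq_measure[OF prob_space.finite_measure[OF \<nu>_prob[of x]], of B]
        by (simp add: emeasure_distr emeasure_N sets_eq_imp_space_eq[OF sets_N] emeasure_eq_measure
            ennreal_mult_eq_top_iff measurable_sets[OF U])
    qed (simp_all add: P_def)
    then have "emeasure (scale_measure (emeasure (\<nu> x) B) (distr (N x) P U)) A
        = emeasure (distr (density M (indicator (E x \<inter> C))) P U) A" by simp
    moreover have "(\<lambda>\<omega>. (U \<omega>, Y j \<omega>)) -` (A \<times> B) \<inter> space M = C \<inter> (U -` A \<inter> space M)"
      by (auto simp: C_def)
    ultimately show "emeasure (distr (N x) P U) A * emeasure (\<nu> x) B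
        = emeasure (distr (N x) (P \<Otimes>\<^sub>M L) (\<lambda>\<omega>. (U \<omega>, Y j \<omega>))) (A \<times> B)"
      using A measurable_sets[OF U A]
      by (simp add: emeasure_distr emeasure_restricted emeasure_N sets_eq_imp_space_eq[OF sets_N] mult.commute Int_assoc)
  qed
  have part: "(\<integral>\<^sup>+\<omega>. indicator (E x) \<omega> * G (U \<omega>, Y j \<omega>) \<partial>M)
      \<le> (\<integral>\<^sup>+\<omega>. \<integral>\<^sup>+y. ennreal (f x y) * G (U \<omega>, y) \<partial>L \<partial>M)" for x
  proof -
    interpret \<nu>: prob_space "\<nu> x" by (rule \<nu>_prob)
    have "(\<integral>\<^sup>+\<omega>. indicator (E x) \<omega> * G (U \<omega>, Y j \<omega>) \<partial>M) = (\<integral>\<^sup>+\<omega>. G (U \<omega>, Y j \<omega>) \<partial>N x)"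
      unfolding N_def by (subst nn_integral_density) auto
    also have "\<dots> = (\<integral>\<^sup>+z. G z \<partial>distr (N x) (P \<Otimes>\<^sub>M L) (\<lambda>\<omega>. (U \<omega>, Y j \<omega>)))"
      by (subst nn_integral_distr) auto
    also have "\<dots> = (\<integral>\<^sup>+u. \<integral>\<^sup>+y. G (u, y) \<partial>\<nu> x \<partial>distr (N x) P U)"
      unfolding pair[symmetric] by (subst \<nu>.nn_integral_fst) auto
    also have "\<dots> = (\<integral>\<^sup>+\<omega>. \<integral>\<^sup>+y. G (U \<omega>, y) \<partial>\<nu> x \<partial>N x)"
      by (subst nn_integral_distr) auto
    also have "\<dots> = (\<integral>\<^sup>+\<omega>. indicator (E x) \<omega> * (\<integral>\<^sup>+y. G (U \<omega>, y) \<partial>\<nu> x) \<partial>M)"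
      unfolding N_def by (subst nn_integral_density) auto
    \<comment> \<open>The one inequality of this chain: the past is no longer restricted to
      \<open>E x\<close>.\<close>
    also have "\<dots> \<le> (\<integral>\<^sup>+\<omega>. (\<integral>\<^sup>+y. G (U \<omega>, y) \<partial>\<nu> x) \<partial>M)"
      by (intro nn_integral_mono) (auto split: split_indicator)
    also have "\<dots> = (\<integral>\<^sup>+\<omega>. \<integral>\<^sup>+y. ennreal (f x y) * G (U \<omega>, y) \<partial>L \<partial>M)"
      unfolding \<nu>_def
      by (intro nn_integral_cong nn_integral_density) (use measurable_space[OF U] in auto)
    finally show ?thesis .
  qed
  interpret L: sigma_finite_measure L
    unfolding L_def leb_def using hmm
    by (intro sigma_finite_measure_restrict_space sigma_finite_lborel)
      (simp add: hidden_markov_model_def)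
  have "(\<integral>\<^sup>+\<omega>. G (U \<omega>, Y j \<omega>) \<partial>M) = (\<integral>\<^sup>+\<omega>. (\<Sum>x\<in>UNIV. indicator (E x) \<omega> * G (U \<omega>, Y j \<omega>)) \<partial>M)"
  proof (intro nn_integral_cong)
    fix \<omega> assume "\<omega> \<in> space M"
    then have "(\<Sum>x\<in>UNIV. indicator (E x) \<omega> * G (U \<omega>, Y j \<omega>)) = (\<Sum>x\<in>UNIV. if x = X j \<omega> then G (U \<omega>, Y j \<omega>) else 0)"
      by (intro sum.cong) (auto simp: E_def)
    then show "G (U \<omega>, Y j \<omega>) = (\<Sum>x\<in>UNIV. indicator (E x) \<omega> * G (U \<omega>, Y j \<omega>))" by simp
  qed
  also have "\<dots> = (\<Sum>x\<in>UNIV. \<integral>\<^sup>+\<omega>. indicator (E x) \<omega> * G (U \<omega>, Y j \<omega>) \<partial>M)"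
    by (intro nn_integral_sum) auto
  also have "\<dots> \<le> (\<Sum>x\<in>UNIV. \<integral>\<^sup>+\<omega>. \<integral>\<^sup>+y. ennreal (f x y) * G (U \<omega>, y) \<partial>L \<partial>M)"
    by (intro sum_mono part)
  also have "\<dots> = (\<integral>\<^sup>+\<omega>. (\<Sum>x\<in>UNIV. \<integral>\<^sup>+y. ennreal (f x y) * G (U \<omega>, y) \<partial>L) \<partial>M)"
    by (intro nn_integral_sum[symmetric]) measurable
  also have "\<dots> = (\<integral>\<^sup>+\<omega>. \<integral>\<^sup>+y. (\<Sum>x\<in>UNIV. ennreal (f x y) * G (U \<omega>, y)) \<partial>L \<partial>M)"
    by (intro nn_integral_cong nn_integral_sum[symmetric]) (use measurable_space[OF U] in auto)
  also have "\<dots> = (\<integral>\<^sup>+\<omega>. \<integral>\<^sup>+y. ennreal (\<Sum>x\<in>UNIV. f x y) * G (U \<omega>, y) \<partial>L \<partial>M)"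
    using dens(2) by (intro nn_integral_cong) (simp add: sum_distrib_right[symmetric])
  finally show ?thesis by (simp add: L_def)
qed

subsection \<open>Stochastic and permuted matrices\<close>

lemma perm_matrix_conj:
  "perm_matrix \<tau> ** A ** transpose (perm_matrix \<tau>) = (\<chi> x z. A $ \<tau> x $ \<tau> z)"
  by (simp add: vec_eq_iff perm_matrix_def matrix_matrix_mult_def transpose_def if_distrib if_distribR
      cong: if_cong)

lemma min_entry_le: "min_entry Q \<le> Q $ x $ z"
  unfolding min_entry_def by (rule Min_le) (auto intro!: image_eqI[of _ _ "(x, z)"])

lemma le_min_entry: "(\<And>x z. b \<le> Q $ x $ z) \<Longrightarrow> b \<le> min_entry Q"
  unfolding min_entry_def by (subst Min_ge_iff) auto

text \<open>At least two entries share the mass 1 of a row. Applied to the true and to the estimated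
  matrix, this gives \<open>\<delta> + \<delta>h \<omega> \<le> 1\<close>, by which a sum of
  reciprocals is at most their product.\<close>

lemma min_entry_le_half:
  fixes Q :: "real^'k^'k::finite"
  assumes "CARD('k) \<ge> 2" "transition_matrix Q"
  shows "min_entry Q \<le> 1 / 2"
proof -
  have "real CARD('k) * min_entry Q \<le> 1"
  proof -
    have "(\<Sum>z\<in>(UNIV::'k set). min_entry Q) \<le> (\<Sum>z\<in>UNIV. Q $ undefined $ z)"
      by (intro sum_mono min_entry_le)
    then show ?thesis
      using assms(2) by (simp add: transition_matrix_def prob_vector_def)
  qed
  moreover have "0 \<le> min_entry Q"
    using assms(2) by (intro le_min_entry) (simp add: transition_matrix_def prob_vector_def)
  then have "2 * min_entry Q \<le> real CARD('k) * min_entry Q"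
    using assms(1) by (intro mult_right_mono) auto
  ultimately show ?thesis by simp
qed

text \<open>Each entry of a stationary law is an average of a column of \<open>Q\<close>. This is
  where stationarity enters: it gives the initial law the lower bound that the transitions provide
  at later times.\<close>

lemma stationary_ge_min_entry:
  assumes "prob_vector \<pi>" "\<pi> v* Q = \<pi>"
  shows "min_entry Q \<le> \<pi> $ x"
proof -
  have "min_entry Q = (\<Sum>z\<in>UNIV. min_entry Q * \<pi> $ z)"
    using assms(1) by (simp add: prob_vector_def sum_distrib_left[symmetric])
  also have "\<dots> \<le> (\<Sum>z\<in>UNIV. Q $ z $ x * \<pi> $ z)"
    using assms(1) by (intro sum_mono mult_right_mono min_entry_le) (simp add: prob_vector_def)
  also have "\<dots> = (\<pi> v* Q) $ x"
    by (simp add: vector_matrix_mult_def mult.commute)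
  finally show ?thesis by (simp add: assms(2))
qed

lemma prob_vector_permute:
  assumes "\<tau> permutes UNIV" "prob_vector v"
  shows "prob_vector (\<chi> x. v $ \<tau> x)"
proof -
  have "(\<Sum>x\<in>UNIV. v $ \<tau> x) = (\<Sum>x\<in>UNIV. v $ x)"
    using assms(1) by (simp add: sum.permute[of \<tau> UNIV "($) v"] o_def)
  then show ?thesis
    using assms(2) by (simp add: prob_vector_def)
qed

lemma borel_measurable_min_entry:
  assumes "Q \<in> borel_measurable P"
  shows "(\<lambda>u. min_entry (Q u)) \<in> borel_measurable P"
proof -
  have "(\<lambda>u. Min ((\<lambda>i. Q u $ fst i $ snd i) ` UNIV)) \<in> borel_measurable P"
    by (intro borel_measurable_Min measurable_compose[OF assms] borel_measurable_continuous_onI continuous_intros) simp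
  then show ?thesis
    by (simp add: min_entry_def case_prod_unfold)
qed

text \<open>Settles the smoothing bound when the estimated minimum vanishes with positive
  probability: its right side is then infinite, whatever the numerators are.\<close>

lemma nn_integral_quot_top_eq_top:
  assumes [measurable]: "f \<in> borel_measurable M" "e \<in> borel_measurable M"
    and "\<not> (AE \<omega> in M. e \<omega> \<noteq> 0)"
  shows "(\<integral>\<^sup>+\<omega>. quot_top (f \<omega>) (e \<omega>) \<partial>M) = \<infinity>"
proof (rule ccontr)
  assume "(\<integral>\<^sup>+\<omega>. quot_top (f \<omega>) (e \<omega>) \<partial>M) \<noteq> \<infinity>"
  moreover have "(\<lambda>\<omega>. quot_top (f \<omega>) (e \<omega>)) \<in> borel_measurable M"
    unfolding quot_top_def by measurable
  ultimately have "AE \<omega> in M. quot_top (f \<omega>) (e \<omega>) \<noteq> \<infinity>"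
    by (intro nn_integral_PInf_AE)
  then have "AE \<omega> in M. e \<omega> \<noteq> 0"
    by eventually_elim (auto simp: quot_top_def)
  with assms(3) show False by simp
qed

subsection \<open>The bounds in expectation\<close>

theorem theorem2p4:
  fixes M :: "'w measure"
    and \<Y> :: "(real^'d::finite) set"
    and \<pi>s :: "real^'k::finite" and Qs :: "real^'k^'k" and fs :: "'k \<Rightarrow> real^'d \<Rightarrow> real"
    and X :: "nat \<Rightarrow> 'w \<Rightarrow> 'k" and Y :: "nat \<Rightarrow> 'w \<Rightarrow> real^'d"
    and p n :: nat
    and \<pi>h :: "(nat \<Rightarrow> real^'d) \<Rightarrow> real^'k" and Qh :: "(nat \<Rightarrow> real^'d) \<Rightarrow> real^'k^'k"
    and fh :: "(nat \<Rightarrow> real^'d) \<Rightarrow> 'k \<Rightarrow> real^'d \<Rightarrow> real"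
    and \<tau> :: "'k \<Rightarrow> 'k"
    and \<delta> C :: real
    and U :: "'w \<Rightarrow> nat \<Rightarrow> real^'d" and V :: "'w \<Rightarrow> nat \<Rightarrow> real^'d"
    and \<pi>\<tau> :: "'w \<Rightarrow> real^'k" and Q\<tau> :: "'w \<Rightarrow> real^'k^'k"
    and f\<tau> :: "'w \<Rightarrow> 'k \<Rightarrow> real^'d \<Rightarrow> real"
    and \<delta>h :: "'w \<Rightarrow> real"
  assumes K: "CARD('k) \<ge> 2"
    and hmm: "hidden_markov_model M \<Y> \<pi>s Qs fs X Y"
    and est: "estimators \<Y> p \<pi>h Qh fh"
    and delta: "\<delta> = min_entry Qs" "\<delta> > 0"
    and stationary: "\<pi>s v* Qs = \<pi>s"
    and C: "C = 4 * (1 - \<delta>) / \<delta>"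
    and n: "n \<ge> 1"
    and perm: "\<tau> permutes UNIV"
    and U: "\<And>\<omega>. U \<omega> = (\<lambda>j\<in>{1..p}. Y j \<omega>)"
    and V: "\<And>\<omega> j. V \<omega> j = Y (p + j) \<omega>"
    and pi_tau: "\<And>\<omega>. \<pi>\<tau> \<omega> = perm_matrix \<tau> *v \<pi>h (U \<omega>)"
    and Q_tau: "\<And>\<omega>. Q\<tau> \<omega> = perm_matrix \<tau> ** Qh (U \<omega>) ** transpose (perm_matrix \<tau>)"
    and f_tau: "\<And>\<omega> x. f\<tau> \<omega> x = fh (U \<omega>) (\<tau> x)"
    and delta_hat: "\<And>\<omega>. \<delta>h \<omega> = min_entry (Qh (U \<omega>))"
    and denom: "AE \<omega> in M. \<forall>k\<in>{1..n}. filtering_denom (\<pi>\<tau> \<omega>) (Q\<tau> \<omega>) (f\<tau> \<omega>) k (V \<omega>) > 0"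
  shows
    "(SUP k\<in>{1..n}. \<integral>\<^sup>+\<omega>. ennreal (tv_dist (filtering \<pi>s Qs fs k (V \<omega>))
          (filtering (\<pi>\<tau> \<omega>) (Q\<tau> \<omega>) (f\<tau> \<omega>) k (V \<omega>))) \<partial>M)
       \<le> ennreal (C / \<delta>\<^sup>2) *
          ((\<integral>\<^sup>+\<omega>. ennreal (norm (\<pi>s - \<pi>\<tau> \<omega>)) \<partial>M)
           + (\<integral>\<^sup>+\<omega>. ennreal (norm (Qs - Q\<tau> \<omega>)) \<partial>M)
           + (\<Sum>x\<in>UNIV. \<integral>\<^sup>+\<omega>. L1_norm_on \<Y> (\<lambda>y. fs x y - f\<tau> \<omega> x y) \<partial>M))
     \<and>
     (SUP k\<in>{1..n}. \<integral>\<^sup>+\<omega>. ennreal (tv_dist (smoothing \<pi>s Qs fs n k (V \<omega>))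
          (smoothing (\<pi>\<tau> \<omega>) (Q\<tau> \<omega>) (f\<tau> \<omega>) n k (V \<omega>))) \<partial>M)
       \<le> ennreal (C / \<delta>\<^sup>2) *
          ((\<integral>\<^sup>+\<omega>. ennreal (norm (\<pi>s - \<pi>\<tau> \<omega>)) \<partial>M)
           + (\<integral>\<^sup>+\<omega>. quot_top (ennreal (norm (Qs - Q\<tau> \<omega>))) (\<delta>h \<omega>) \<partial>M)
           + (\<Sum>x\<in>UNIV. \<integral>\<^sup>+\<omega>. quot_top (L1_norm_on \<Y> (\<lambda>y. fs x y - f\<tau> \<omega> x y)) (\<delta>h \<omega>) \<partial>M))"
proof -
  interpret prob_space M using hmm by (simp add: hidden_markov_model_def)
  define P where "P = PiM {1..p} (\<lambda>_. leb \<Y>)"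
  have U_eq: "U = (\<lambda>\<omega>. \<lambda>j\<in>{1..p}. Y j \<omega>)" using U by auto
  have space_L: "space (leb \<Y>) = \<Y>" by (simp add: leb_def space_restrict_space)
  have Y_meas: "j \<ge> 1 \<Longrightarrow> Y j \<in> measurable M (leb \<Y>)" for j
    using hmm by (simp add: hidden_markov_model_def)
  have U_meas[measurable]: "U \<in> measurable M P"
    unfolding U_eq P_def by (intro measurable_restrict Y_meas) simp
  have V_meas: "j \<ge> 1 \<Longrightarrow> (\<lambda>\<omega>. V \<omega> j) \<in> measurable M (leb \<Y>)" for j
    unfolding V by (intro Y_meas) simp
  have U_space: "U \<omega> \<in> {1..p} \<rightarrow>\<^sub>E \<Y>" and V_space: "j \<ge> 1 \<Longrightarrow> V \<omega> j \<in> \<Y>" if "\<omega> \<in> space M" for \<omega> j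
    using measurable_space[OF U_meas that] measurable_space[OF V_meas that]
    by (auto simp: P_def space_PiM space_L)
  have fs: "fs x \<in> borel_measurable (leb \<Y>)" "y \<in> \<Y> \<Longrightarrow> 0 \<le> fs x y" for x y
    using hmm by (auto simp: hidden_markov_model_def prob_density_on_def)
  note [measurable] = fs(1)
  have Qs: "transition_matrix Qs" and \<pi>s: "prob_vector \<pi>s"
    using hmm by (auto simp: hidden_markov_model_def)
  have \<delta>: "0 < \<delta>" "\<delta> \<le> 1 / 2"
    using delta min_entry_le_half[OF K Qs] by auto
  have \<pi>h_meas[measurable]: "\<pi>h \<in> borel_measurable P" and Qh_meas[measurable]: "Qh \<in> borel_measurable P"
    and fh_meas: "(\<lambda>(u, y). fh u x y) \<in> borel_measurable (P \<Otimes>\<^sub>M leb \<Y>)" for x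
    using est by (auto simp: estimators_def P_def)
  have fh_meas'[measurable]: "(\<lambda>z. fh (fst z) x (snd z)) \<in> borel_measurable (P \<Otimes>\<^sub>M leb \<Y>)" for x
    using fh_meas[of x] by (simp add: case_prod_unfold)
  have hat: "prob_vector (\<pi>h (U \<omega>))" "transition_matrix (Qh (U \<omega>))" "y \<in> \<Y> \<Longrightarrow> 0 \<le> fh (U \<omega>) x y"
    if "\<omega> \<in> space M" for \<omega> x y
    using est U_space[OF that] by (auto simp: estimators_def)
  have \<pi>\<tau>_eq: "\<pi>\<tau> \<omega> = (\<chi> x. \<pi>h (U \<omega>) $ \<tau> x)" for \<omega>
    by (simp add: vec_eq_iff pi_tau perm_matrix_mult_vec)
  have Q\<tau>_eq: "Q\<tau> \<omega> = (\<chi> x z. Qh (U \<omega>) $ \<tau> x $ \<tau> z)" for \<omega>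
    by (simp add: Q_tau perm_matrix_conj)
  have Q\<tau>_row: "Q\<tau> \<omega> $ x = (\<chi> z. Qh (U \<omega>) $ \<tau> x $ \<tau> z)" for \<omega> x
    by (simp add: Q\<tau>_eq)
  have \<delta>h: "0 \<le> \<delta>h \<omega>" "\<delta>h \<omega> \<le> 1 / 2" if "\<omega> \<in> space M" for \<omega>
    using hat[OF that] min_entry_le_half[OF K hat(2)[OF that]]
    by (auto simp: delta_hat transition_matrix_def prob_vector_def intro: le_min_entry)
  have \<delta>h_meas': "(\<lambda>u. min_entry (Qh u)) \<in> borel_measurable P"
    by (intro borel_measurable_min_entry Qh_meas)
  note [measurable] = \<delta>h_meas'
  have \<delta>h_meas[measurable]: "\<delta>h \<in> borel_measurable M"
    using measurable_compose[OF U_meas \<delta>h_meas'] by (simp add: delta_hat[abs_def])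
  have [measurable]: "(\<lambda>\<omega>. norm (\<pi>s - \<pi>\<tau> \<omega>)) \<in> borel_measurable M"
    unfolding \<pi>\<tau>_eq
    by (intro measurable_compose[OF measurable_compose[OF U_meas \<pi>h_meas]] borel_measurable_continuous_onI continuous_intros)
  have [measurable]: "(\<lambda>\<omega>. norm (Qs - Q\<tau> \<omega>)) \<in> borel_measurable M"
    unfolding Q\<tau>_eq
    by (intro measurable_compose[OF measurable_compose[OF U_meas Qh_meas]] borel_measurable_continuous_onI continuous_intros)
  interpret L: sigma_finite_measure "leb \<Y>"
    unfolding leb_def using hmm
    by (intro sigma_finite_measure_restrict_space sigma_finite_lborel)
      (simp add: hidden_markov_model_def)
  define \<Lambda> where "\<Lambda> x u = L1_norm_on \<Y> (\<lambda>y. fs x y - fh u (\<tau> x) y)" for x u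
  have [measurable]: "\<Lambda> x \<in> borel_measurable P" for x
    unfolding \<Lambda>_def L1_norm_on_def by measurable
  define c where "c = C / \<delta>\<^sup>2"
  \<comment> \<open>Since \<open>K \<ge> 2\<close> forces \<open>\<delta> \<le> 1/2\<close>, the factor \<open>1 - \<delta>\<close> in \<open>C\<close> costs at most 2.\<close>
  have c: "2 / \<delta> ^ 3 \<le> c"
    using \<delta> by (simp add: c_def C power2_eq_square power3_eq_cube divide_simps)
  have c_ge: "2 / \<delta> \<le> c" "2 / \<delta>\<^sup>2 \<le> c"
  proof -
    have "\<delta> ^ 3 \<le> \<delta> ^ 2" "\<delta> ^ 3 \<le> \<delta> ^ 1"
      using \<delta> by (intro power_decreasing; simp)+
    then have "2 / \<delta>\<^sup>2 \<le> 2 / \<delta> ^ 3" "2 / \<delta> \<le> 2 / \<delta> ^ 3"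
      using \<delta> by (auto intro!: divide_left_mono)
    with c show "2 / \<delta> \<le> c" "2 / \<delta>\<^sup>2 \<le> c" by auto
  qed
  have c_pos: "0 < c" using c_ge(1) \<delta> by (meson divide_pos_pos less_le_trans zero_less_numeral)
  \<comment> \<open>\<open>b\<close> stands for a geometric weight, which is random through
    \<open>\<delta>h\<close> and hence a function of the first \<open>p\<close> observations. It
    passes unchanged through the bound on the joint law.\<close>
  have conditional: "(\<integral>\<^sup>+\<omega>. ennreal (b (U \<omega>)) * ennreal (rel_err fs (f\<tau> \<omega>) (V \<omega> l)) \<partial>M)
      \<le> (\<integral>\<^sup>+\<omega>. ennreal (b (U \<omega>)) * (\<Sum>x\<in>UNIV. \<Lambda> x (U \<omega>)) \<partial>M)"
    if b[measurable]: "b \<in> borel_measurable P" and l: "l \<ge> 1" for b :: "(nat \<Rightarrow> real^'d) \<Rightarrow> real" and l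
  proof -
    define G where "G z = ennreal (b (fst z)) * ennreal (rel_err fs (\<lambda>x. fh (fst z) (\<tau> x)) (snd z))" for z
    have G[measurable]: "G \<in> borel_measurable (P \<Otimes>\<^sub>M leb \<Y>)"
      unfolding G_def rel_err_def by measurable
    have "(\<integral>\<^sup>+\<omega>. ennreal (b (U \<omega>)) * ennreal (rel_err fs (f\<tau> \<omega>) (V \<omega> l)) \<partial>M) = (\<integral>\<^sup>+\<omega>. G (U \<omega>, Y (p + l) \<omega>) \<partial>M)"
      by (simp add: G_def V f_tau[abs_def])
    also have "\<dots> \<le> (\<integral>\<^sup>+\<omega>. \<integral>\<^sup>+y. ennreal (\<Sum>x\<in>UNIV. fs x y) * G (U \<omega>, y) \<partial>leb \<Y> \<partial>M)"
      using nn_integral_hidden_markov_le[OF hmm, of p "p + l" G] G l by (simp add: U_eq P_def)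
    also have "\<dots> \<le> (\<integral>\<^sup>+\<omega>. \<integral>\<^sup>+y. ennreal (b (U \<omega>)) * (\<Sum>x\<in>UNIV. ennreal \<bar>fs x y - fh (U \<omega>) (\<tau> x) y\<bar>) \<partial>leb \<Y> \<partial>M)"
    proof (intro nn_integral_mono)
      fix \<omega> y assume "y \<in> space (leb \<Y>)"
      then have s: "0 \<le> (\<Sum>x\<in>UNIV. fs x y)"
        by (intro sum_nonneg fs) (simp add: space_L)
      let ?r = "\<Sum>x\<in>UNIV. \<bar>fs x y - fh (U \<omega>) (\<tau> x) y\<bar>"
      \<comment> \<open>The sum cancels the denominator of \<open>rel_err\<close> where it is
        positive; at its zeros the left side is 0.\<close>
      have "ennreal (\<Sum>x\<in>UNIV. fs x y) * ennreal (rel_err fs (\<lambda>x. fh (U \<omega>) (\<tau> x)) y) \<le> ennreal ?r"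
        unfolding ennreal_mult'[OF s, symmetric] rel_err_def
        by (intro ennreal_leI) (auto simp: sum_nonneg)
      then have "ennreal (b (U \<omega>)) * (ennreal (\<Sum>x\<in>UNIV. fs x y) * ennreal (rel_err fs (\<lambda>x. fh (U \<omega>) (\<tau> x)) y))
          \<le> ennreal (b (U \<omega>)) * ennreal ?r"
        by (rule mult_left_mono) simp
      then show "ennreal (\<Sum>x\<in>UNIV. fs x y) * G (U \<omega>, y)
          \<le> ennreal (b (U \<omega>)) * (\<Sum>x\<in>UNIV. ennreal \<bar>fs x y - fh (U \<omega>) (\<tau> x) y\<bar>)"
        by (simp add: G_def mult_ac)
    qed
    also have "\<dots> = (\<integral>\<^sup>+\<omega>. ennreal (b (U \<omega>)) * (\<Sum>x\<in>UNIV. \<Lambda> x (U \<omega>)) \<partial>M)"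
    proof (intro nn_integral_cong)
      fix \<omega> assume \<omega>: "\<omega> \<in> space M"
      have [measurable]: "(\<lambda>y. fh (U \<omega>) x y) \<in> borel_measurable (leb \<Y>)" for x
        using measurable_compose[OF measurable_Pair1'[OF measurable_space[OF U_meas \<omega>]] fh_meas'[of x]] by simp
      show "(\<integral>\<^sup>+y. ennreal (b (U \<omega>)) * (\<Sum>x\<in>UNIV. ennreal \<bar>fs x y - fh (U \<omega>) (\<tau> x) y\<bar>) \<partial>leb \<Y>)
          = ennreal (b (U \<omega>)) * (\<Sum>x\<in>UNIV. \<Lambda> x (U \<omega>))"
        unfolding \<Lambda>_def L1_norm_on_def
        by (subst nn_integral_cmult) (auto simp del: sum_ennreal simp: nn_integral_sum)
    qed
    finally show ?thesis .
  qed
  have density_pos: "AE \<omega> in M. \<forall>j\<in>{1..n}. 0 < (\<Sum>x\<in>UNIV. fs x (V \<omega> j))"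
  proof (rule AE_finite_allI)
    fix j assume "j \<in> {1..n}"
    then have j: "j \<ge> 1" by simp
    \<comment> \<open>With this indicator the bound on the joint law integrates the density sum over
      its own zeros, which gives 0.\<close>
    define G where "G z = (indicator {y. (\<Sum>x\<in>UNIV. fs x y) = 0} (snd z) :: ennreal)" for z :: "(nat \<Rightarrow> real^'d) \<times> (real^'d)"
    have G[measurable]: "G \<in> borel_measurable (P \<Otimes>\<^sub>M leb \<Y>)"
      unfolding G_def indicator_def mem_Collect_eq by measurable
    have "(\<integral>\<^sup>+\<omega>. G (U \<omega>, V \<omega> j) \<partial>M) \<le> (\<integral>\<^sup>+\<omega>. \<integral>\<^sup>+y. ennreal (\<Sum>x\<in>UNIV. fs x y) * G (U \<omega>, y) \<partial>leb \<Y> \<partial>M)"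
      using nn_integral_hidden_markov_le[OF hmm, of p "p + j" G] G j by (simp add: U_eq P_def V)
    also have "\<dots> = (\<integral>\<^sup>+\<omega>. \<integral>\<^sup>+y. 0 \<partial>leb \<Y> \<partial>M)"
      by (intro nn_integral_cong) (auto simp: G_def split: split_indicator)
    finally have "(\<integral>\<^sup>+\<omega>. G (U \<omega>, V \<omega> j) \<partial>M) = 0" by simp
    moreover have [measurable]: "(\<lambda>\<omega>. G (U \<omega>, V \<omega> j)) \<in> borel_measurable M"
      using V_meas[OF j] by measurable
    ultimately have "AE \<omega> in M. G (U \<omega>, V \<omega> j) = 0"
      by (simp add: nn_integral_0_iff_AE)
    then show "AE \<omega> in M. 0 < (\<Sum>x\<in>UNIV. fs x (V \<omega> j))"
      using AE_space
    proof eventually_elim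
      case (elim \<omega>)
      then have "0 \<le> (\<Sum>x\<in>UNIV. fs x (V \<omega> j))"
        using V_space j by (intro sum_nonneg fs) auto
      with elim show ?case
        by (auto simp: G_def less_le split: split_indicator_asm)
    qed
  qed simp
  define Dp where "Dp \<omega> = norm (\<pi>s - \<pi>\<tau> \<omega>)" for \<omega>
  define Dq where "Dq \<omega> = norm (Qs - Q\<tau> \<omega>)" for \<omega>
  have [measurable]: "Dp \<in> borel_measurable M" "Dq \<in> borel_measurable M"
    by (simp_all add: Dp_def[abs_def] Dq_def[abs_def])
  have D_nonneg: "0 \<le> Dp \<omega>" "0 \<le> Dq \<omega>" for \<omega> by (simp_all add: Dp_def Dq_def)
  have pointwise: "AE \<omega> in M. tv_dist (smoothing \<pi>s Qs fs m k (V \<omega>)) (smoothing (\<pi>\<tau> \<omega>) (Q\<tau> \<omega>) (f\<tau> \<omega>) m k (V \<omega>))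
      \<le> (\<Sum>l\<in>{1..m}. geo_weight \<delta> (\<delta>h \<omega>) k l *
            ((if l = 1 then Dp \<omega> else Dq \<omega>) / \<delta> + rel_err fs (f\<tau> \<omega>) (V \<omega> l) / \<delta>\<^sup>2))"
    if m: "m \<in> {1..n}" and k: "k \<in> {1..m}" and pos: "AE \<omega> in M. k < m \<longrightarrow> 0 < \<delta>h \<omega>" for m k
    using denom density_pos pos AE_space
  proof eventually_elim
    case (elim \<omega>)
    show ?case
      unfolding Dp_def Dq_def
    proof (rule smoothing_perturbation)
      show "prob_vector (\<pi>\<tau> \<omega>)"
        unfolding \<pi>\<tau>_eq by (rule prob_vector_permute[OF perm hat(1)[OF elim(4)]])
      show "transition_matrix (Q\<tau> \<omega>)"
        unfolding transition_matrix_def Q\<tau>_row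
        using prob_vector_permute[OF perm] hat(2)[OF elim(4)] by (simp add: transition_matrix_def)
      show "\<delta> \<le> \<pi>s $ x" for x
        unfolding delta(1) by (rule stationary_ge_min_entry[OF \<pi>s stationary])
      show "\<delta> \<le> Qs $ x $ z" for x z
        unfolding delta(1) by (rule min_entry_le)
      show "\<delta>h \<omega> \<le> Q\<tau> \<omega> $ x $ z" for x z
        by (simp add: delta_hat Q\<tau>_eq min_entry_le)
      show "0 \<le> fs x (V \<omega> j)" "0 \<le> f\<tau> \<omega> x (V \<omega> j)" if "1 \<le> j" for j x
        using V_space[OF elim(4) that] fs hat(3)[OF elim(4)] by (auto simp: f_tau)
    qed (use elim m k \<delta> \<delta>h[OF elim(4)] \<pi>s Qs in auto)
  qed
  \<comment> \<open>One estimate for both bounds: filtering takes \<open>m = k\<close> with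
    \<open>a\<close> constantly 1, smoothing takes \<open>m = n\<close> with
    \<open>a = inverse\<close>. The factor \<open>a (\<delta>h \<omega>)\<close> is what the total
    geometric weight exceeds \<open>2 / \<delta>\<close> by, at most.\<close>
  have core: "(\<integral>\<^sup>+\<omega>. ennreal (tv_dist (smoothing \<pi>s Qs fs m k (V \<omega>))
          (smoothing (\<pi>\<tau> \<omega>) (Q\<tau> \<omega>) (f\<tau> \<omega>) m k (V \<omega>))) \<partial>M)
      \<le> ennreal c * ((\<integral>\<^sup>+\<omega>. ennreal (Dp \<omega>) \<partial>M) + (\<integral>\<^sup>+\<omega>. ennreal (a (\<delta>h \<omega>)) * ennreal (Dq \<omega>) \<partial>M)
          + (\<Sum>x\<in>UNIV. \<integral>\<^sup>+\<omega>. ennreal (a (\<delta>h \<omega>)) * \<Lambda> x (U \<omega>) \<partial>M))"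
    if m: "m \<in> {1..n}" and k: "k \<in> {1..m}" and pos: "AE \<omega> in M. k < m \<longrightarrow> 0 < \<delta>h \<omega>"
      and a[measurable]: "a \<in> borel_measurable borel"
      and W: "AE \<omega> in M. (\<Sum>l\<in>{1..m}. geo_weight \<delta> (\<delta>h \<omega>) k l) \<le> 2 / \<delta> * a (\<delta>h \<omega>)"
    for m k and a :: "real \<Rightarrow> real"
  proof -
    define w where "w l \<omega> = geo_weight \<delta> (\<delta>h \<omega>) k l" for l \<omega>
    have w_meas[measurable]: "w l \<in> borel_measurable M" for l
      unfolding w_def geo_weight_def by measurable
    have w_nonneg: "0 \<le> w l \<omega>" if "\<omega> \<in> space M" for l \<omega>
      using \<delta> \<delta>h[OF that] by (simp add: w_def geo_weight_def)
    let ?r = "\<lambda>l \<omega>. rel_err fs (f\<tau> \<omega>) (V \<omega> l)"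
    have r_meas[measurable]: "?r l \<in> borel_measurable M" if "l \<ge> 1" for l
    proof -
      note [measurable] = V_meas[OF that]
      have "(\<lambda>\<omega>. fh (U \<omega>) x (V \<omega> l)) \<in> borel_measurable M" for x
        using measurable_compose[OF _ fh_meas'[of x], of "\<lambda>\<omega>. (U \<omega>, V \<omega> l)" M] by simp
      note [measurable] = this
      show ?thesis unfolding rel_err_def f_tau by measurable
    qed
    have "(\<integral>\<^sup>+\<omega>. ennreal (tv_dist (smoothing \<pi>s Qs fs m k (V \<omega>))
          (smoothing (\<pi>\<tau> \<omega>) (Q\<tau> \<omega>) (f\<tau> \<omega>) m k (V \<omega>))) \<partial>M)
        \<le> (\<integral>\<^sup>+\<omega>. (ennreal c * ennreal (Dp \<omega>) + ennreal c * (ennreal (a (\<delta>h \<omega>)) * ennreal (Dq \<omega>)))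
            + (\<Sum>l\<in>{1..m}. ennreal (w l \<omega> / \<delta>\<^sup>2) * ennreal (?r l \<omega>)) \<partial>M)"
    proof (rule nn_integral_mono_AE)
      show "AE \<omega> in M. ennreal (tv_dist (smoothing \<pi>s Qs fs m k (V \<omega>))
          (smoothing (\<pi>\<tau> \<omega>) (Q\<tau> \<omega>) (f\<tau> \<omega>) m k (V \<omega>)))
        \<le> (ennreal c * ennreal (Dp \<omega>) + ennreal c * (ennreal (a (\<delta>h \<omega>)) * ennreal (Dq \<omega>)))
            + (\<Sum>l\<in>{1..m}. ennreal (w l \<omega> / \<delta>\<^sup>2) * ennreal (?r l \<omega>))"
        using pointwise[OF m k pos] W density_pos AE_space
      proof eventually_elim
        case (elim \<omega>)
        note w0 = w_nonneg[OF elim(4)]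
        have r0: "0 \<le> ?r l \<omega>" if "l \<in> {1..m}" for l
          using elim(3) that m by (force simp: rel_err_def intro!: divide_nonneg_nonneg sum_nonneg less_imp_le[of 0 "sum _ _"])
        have Wa: "(\<Sum>l\<in>{1..m}. w l \<omega>) \<le> 2 / \<delta> * a (\<delta>h \<omega>)" using elim(2) by (simp add: w_def)
        then have "0 \<le> 2 / \<delta> * a (\<delta>h \<omega>)" using w0 by (meson order_trans sum_nonneg)
        then have a0: "0 \<le> a (\<delta>h \<omega>)" using \<delta> by (simp add: zero_le_divide_iff)
        \<comment> \<open>The error of the initial law occurs at \<open>l = 1\<close> only, where
          the weight is at most 2 because \<open>1 \<le> k\<close>. Split off here, it avoids the
          factor \<open>a\<close>; the added \<open>w 1 \<omega> * Dq \<omega>\<close> completes the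
          sum over all times.\<close>
        have "(\<Sum>l\<in>{1..m}. w l \<omega> * (if l = 1 then Dp \<omega> else Dq \<omega>))
            \<le> (\<Sum>l\<in>{1..m}. (if l = 1 then 2 * Dp \<omega> else 0) + w l \<omega> * Dq \<omega>)"
        proof (rule sum_mono)
          fix l assume "l \<in> {1..m}"
          have "w 1 \<omega> \<le> 2"
            using k \<delta> by (simp add: w_def geo_weight_def power_le_one)
          then have "w 1 \<omega> * Dp \<omega> \<le> 2 * Dp \<omega>" by (rule mult_right_mono) (rule D_nonneg)
          then show "w l \<omega> * (if l = 1 then Dp \<omega> else Dq \<omega>) \<le> (if l = 1 then 2 * Dp \<omega> else 0) + w l \<omega> * Dq \<omega>"
            using w0[of l] D_nonneg(2)[of \<omega>] by (cases "l = 1") (auto intro: add_increasing2)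
        qed
        also have "\<dots> = 2 * Dp \<omega> + (\<Sum>l\<in>{1..m}. w l \<omega>) * Dq \<omega>"
          using m by (simp add: sum.distrib sum_distrib_right)
        also have "\<dots> \<le> 2 * Dp \<omega> + (2 / \<delta> * a (\<delta>h \<omega>)) * Dq \<omega>"
          using Wa D_nonneg by (intro add_left_mono mult_right_mono) auto
        finally have "(\<Sum>l\<in>{1..m}. w l \<omega> * (if l = 1 then Dp \<omega> else Dq \<omega>)) / \<delta>
            \<le> (2 * Dp \<omega> + (2 / \<delta> * a (\<delta>h \<omega>)) * Dq \<omega>) / \<delta>"
          using \<delta> by (intro divide_right_mono) auto
        also have "\<dots> = 2 / \<delta> * Dp \<omega> + 2 / \<delta>\<^sup>2 * (a (\<delta>h \<omega>) * Dq \<omega>)"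
          using \<delta> by (simp add: field_simps power2_eq_square)
        also have "\<dots> \<le> c * Dp \<omega> + c * (a (\<delta>h \<omega>) * Dq \<omega>)"
          using c_ge a0 D_nonneg by (intro add_mono mult_right_mono) auto
        finally have main: "(\<Sum>l\<in>{1..m}. w l \<omega> * (if l = 1 then Dp \<omega> else Dq \<omega>)) / \<delta>
            \<le> c * Dp \<omega> + c * (a (\<delta>h \<omega>) * Dq \<omega>)" .
        have "tv_dist (smoothing \<pi>s Qs fs m k (V \<omega>)) (smoothing (\<pi>\<tau> \<omega>) (Q\<tau> \<omega>) (f\<tau> \<omega>) m k (V \<omega>))
            \<le> (\<Sum>l\<in>{1..m}. w l \<omega> * (if l = 1 then Dp \<omega> else Dq \<omega>)) / \<delta> + (\<Sum>l\<in>{1..m}. w l \<omega> / \<delta>\<^sup>2 * ?r l \<omega>)"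
          using elim(1) by (simp add: w_def distrib_left sum.distrib sum_divide_distrib)
        also have "\<dots> \<le> (c * Dp \<omega> + c * (a (\<delta>h \<omega>) * Dq \<omega>)) + (\<Sum>l\<in>{1..m}. w l \<omega> / \<delta>\<^sup>2 * ?r l \<omega>)"
          using main by simp
        finally have "ennreal (tv_dist (smoothing \<pi>s Qs fs m k (V \<omega>)) (smoothing (\<pi>\<tau> \<omega>) (Q\<tau> \<omega>) (f\<tau> \<omega>) m k (V \<omega>)))
            \<le> ennreal ((c * Dp \<omega> + c * (a (\<delta>h \<omega>) * Dq \<omega>)) + (\<Sum>l\<in>{1..m}. w l \<omega> / \<delta>\<^sup>2 * ?r l \<omega>))"
          by (rule ennreal_leI)
        also have "\<dots> = (ennreal c * ennreal (Dp \<omega>) + ennreal c * (ennreal (a (\<delta>h \<omega>)) * ennreal (Dq \<omega>)))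
            + (\<Sum>l\<in>{1..m}. ennreal (w l \<omega> / \<delta>\<^sup>2) * ennreal (?r l \<omega>))"
        proof -
          have "ennreal (\<Sum>l\<in>{1..m}. w l \<omega> / \<delta>\<^sup>2 * ?r l \<omega>) = (\<Sum>l\<in>{1..m}. ennreal (w l \<omega> / \<delta>\<^sup>2) * ennreal (?r l \<omega>))"
            using w0 r0 by (subst sum_ennreal[symmetric]) (auto intro!: sum.cong simp: ennreal_mult simp del: times_divide_eq_left)
          moreover have "0 \<le> (\<Sum>l\<in>{1..m}. w l \<omega> / \<delta>\<^sup>2 * ?r l \<omega>)"
            using w0 r0 by (intro sum_nonneg) simp
          ultimately show ?thesis
            using c_pos a0 D_nonneg by (simp add: ennreal_plus ennreal_mult)
        qed
        finally show ?case .
      qed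
    qed
    also have "\<dots> = (\<integral>\<^sup>+\<omega>. ennreal c * ennreal (Dp \<omega>) + ennreal c * (ennreal (a (\<delta>h \<omega>)) * ennreal (Dq \<omega>)) \<partial>M)
        + (\<Sum>l\<in>{1..m}. \<integral>\<^sup>+\<omega>. ennreal (w l \<omega> / \<delta>\<^sup>2) * ennreal (?r l \<omega>) \<partial>M)"
      by (subst nn_integral_add) (auto intro!: nn_integral_sum borel_measurable_sum)
    also have "(\<Sum>l\<in>{1..m}. \<integral>\<^sup>+\<omega>. ennreal (w l \<omega> / \<delta>\<^sup>2) * ennreal (?r l \<omega>) \<partial>M)
        \<le> (\<Sum>l\<in>{1..m}. \<integral>\<^sup>+\<omega>. ennreal (w l \<omega> / \<delta>\<^sup>2) * (\<Sum>x\<in>UNIV. \<Lambda> x (U \<omega>)) \<partial>M)"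
    proof (rule sum_mono)
      fix l assume "l \<in> {1..m}"
      moreover have "(\<lambda>u. geo_weight \<delta> (min_entry (Qh u)) k l / \<delta>\<^sup>2) \<in> borel_measurable P"
        unfolding geo_weight_def by measurable
      ultimately show "(\<integral>\<^sup>+\<omega>. ennreal (w l \<omega> / \<delta>\<^sup>2) * ennreal (?r l \<omega>) \<partial>M)
          \<le> (\<integral>\<^sup>+\<omega>. ennreal (w l \<omega> / \<delta>\<^sup>2) * (\<Sum>x\<in>UNIV. \<Lambda> x (U \<omega>)) \<partial>M)"
        using conditional[of "\<lambda>u. geo_weight \<delta> (min_entry (Qh u)) k l / \<delta>\<^sup>2" l]
        by (simp add: w_def delta_hat)
    qed
    also have "\<dots> = (\<integral>\<^sup>+\<omega>. (\<Sum>l\<in>{1..m}. ennreal (w l \<omega> / \<delta>\<^sup>2) * (\<Sum>x\<in>UNIV. \<Lambda> x (U \<omega>))) \<partial>M)"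
      by (intro nn_integral_sum[symmetric]) measurable
    also have "\<dots> \<le> (\<integral>\<^sup>+\<omega>. (\<Sum>x\<in>UNIV. ennreal c * (ennreal (a (\<delta>h \<omega>)) * \<Lambda> x (U \<omega>))) \<partial>M)"
    proof (rule nn_integral_mono_AE)
      show "AE \<omega> in M. (\<Sum>l\<in>{1..m}. ennreal (w l \<omega> / \<delta>\<^sup>2) * (\<Sum>x\<in>UNIV. \<Lambda> x (U \<omega>)))
          \<le> (\<Sum>x\<in>UNIV. ennreal c * (ennreal (a (\<delta>h \<omega>)) * \<Lambda> x (U \<omega>)))"
        using W AE_space
      proof eventually_elim
        case (elim \<omega>)
        note w0 = w_nonneg[OF elim(2)]
        have Wa: "(\<Sum>l\<in>{1..m}. w l \<omega>) \<le> 2 / \<delta> * a (\<delta>h \<omega>)" using elim(1) by (simp add: w_def)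
        then have "0 \<le> 2 / \<delta> * a (\<delta>h \<omega>)" using w0 by (meson order_trans sum_nonneg)
        then have a0: "0 \<le> a (\<delta>h \<omega>)" using \<delta> by (simp add: zero_le_divide_iff)
        \<comment> \<open>The likelihood terms dictate the constant: total weight
          \<open>2 / \<delta>\<close> times \<open>1 / \<delta>\<^sup>2\<close> per exchange. The
          other two errors come with smaller powers of \<open>1 / \<delta>\<close>.\<close>
        have "(\<Sum>l\<in>{1..m}. w l \<omega> / \<delta>\<^sup>2) \<le> 2 / \<delta> * a (\<delta>h \<omega>) / \<delta>\<^sup>2"
          using Wa by (simp add: sum_divide_distrib[symmetric] divide_right_mono del: divide_divide_eq_left)
        also have "\<dots> = 2 / \<delta> ^ 3 * a (\<delta>h \<omega>)"
          by (simp add: power2_eq_square power3_eq_cube)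
        also have "\<dots> \<le> c * a (\<delta>h \<omega>)"
          using c a0 by (rule mult_right_mono)
        finally have "(\<Sum>l\<in>{1..m}. ennreal (w l \<omega> / \<delta>\<^sup>2)) \<le> ennreal c * ennreal (a (\<delta>h \<omega>))"
          using w0 c_pos a0 by (subst sum_ennreal) (auto simp: ennreal_mult[symmetric] intro: ennreal_leI)
        then have "(\<Sum>l\<in>{1..m}. ennreal (w l \<omega> / \<delta>\<^sup>2)) * (\<Sum>x\<in>UNIV. \<Lambda> x (U \<omega>))
            \<le> ennreal c * ennreal (a (\<delta>h \<omega>)) * (\<Sum>x\<in>UNIV. \<Lambda> x (U \<omega>))"
          by (rule mult_right_mono) simp
        then show ?case
          by (simp only: sum_distrib_right[symmetric] sum_distrib_left[symmetric] mult.assoc)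
      qed
    qed
    also have "\<dots> = (\<Sum>x\<in>UNIV. ennreal c * (\<integral>\<^sup>+\<omega>. ennreal (a (\<delta>h \<omega>)) * \<Lambda> x (U \<omega>) \<partial>M))"
      by (subst nn_integral_sum) (auto simp: nn_integral_cmult)
    also have "(\<integral>\<^sup>+\<omega>. ennreal c * ennreal (Dp \<omega>) + ennreal c * (ennreal (a (\<delta>h \<omega>)) * ennreal (Dq \<omega>)) \<partial>M)
        = ennreal c * (\<integral>\<^sup>+\<omega>. ennreal (Dp \<omega>) \<partial>M) + ennreal c * (\<integral>\<^sup>+\<omega>. ennreal (a (\<delta>h \<omega>)) * ennreal (Dq \<omega>) \<partial>M)"
      by (subst nn_integral_add) (auto simp: nn_integral_cmult)
    finally show ?thesis
      by (simp add: distrib_left sum_distrib_left add_left_mono)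
  qed
  have L1: "L1_norm_on \<Y> (\<lambda>y. fs x y - f\<tau> \<omega> x y) = \<Lambda> x (U \<omega>)" for x \<omega>
    by (simp add: \<Lambda>_def f_tau)
  show ?thesis
    unfolding L1 c_def[symmetric] Dp_def[symmetric] Dq_def[symmetric]
  proof (intro conjI SUP_least)
    fix k assume k: "k \<in> {1..n}"
    show "(\<integral>\<^sup>+\<omega>. ennreal (tv_dist (filtering \<pi>s Qs fs k (V \<omega>)) (filtering (\<pi>\<tau> \<omega>) (Q\<tau> \<omega>) (f\<tau> \<omega>) k (V \<omega>))) \<partial>M)
        \<le> ennreal c * ((\<integral>\<^sup>+\<omega>. ennreal (Dp \<omega>) \<partial>M) + (\<integral>\<^sup>+\<omega>. ennreal (Dq \<omega>) \<partial>M) + (\<Sum>x\<in>UNIV. \<integral>\<^sup>+\<omega>. \<Lambda> x (U \<omega>) \<partial>M))"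
    proof -
      have "smoothing \<pi> Q f k k y = filtering \<pi> Q f k y"
        for \<pi> :: "real^'k" and Q and f :: "'k \<Rightarrow> real^'d \<Rightarrow> real" and y
        by (rule ext) (simp add: smoothing.simps)
      moreover have "AE \<omega> in M. (\<Sum>l\<in>{1..k}. geo_weight \<delta> (\<delta>h \<omega>) k l) \<le> 2 / \<delta> * 1"
        using \<delta> by (intro AE_I2) (simp add: sum_geo_weight_forward del: One_nat_def)
      ultimately show ?thesis
        using core[of k k "\<lambda>_. 1"] k by simp
    qed
    show "(\<integral>\<^sup>+\<omega>. ennreal (tv_dist (smoothing \<pi>s Qs fs n k (V \<omega>)) (smoothing (\<pi>\<tau> \<omega>) (Q\<tau> \<omega>) (f\<tau> \<omega>) n k (V \<omega>))) \<partial>M)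
        \<le> ennreal c * ((\<integral>\<^sup>+\<omega>. ennreal (Dp \<omega>) \<partial>M) + (\<integral>\<^sup>+\<omega>. quot_top (ennreal (Dq \<omega>)) (\<delta>h \<omega>) \<partial>M)
            + (\<Sum>x\<in>UNIV. \<integral>\<^sup>+\<omega>. quot_top (\<Lambda> x (U \<omega>)) (\<delta>h \<omega>) \<partial>M))"
    proof (cases "AE \<omega> in M. \<delta>h \<omega> \<noteq> 0")
      case False
      then have "(\<integral>\<^sup>+\<omega>. quot_top (ennreal (Dq \<omega>)) (\<delta>h \<omega>) \<partial>M) = \<infinity>"
        by (intro nn_integral_quot_top_eq_top) auto
      then show ?thesis using c_pos by (simp add: ennreal_mult_eq_top_iff ennreal_mult_top)
    next
      case True
      then have pos: "AE \<omega> in M. 0 < \<delta>h \<omega>"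
        using AE_space by eventually_elim (use \<delta>h(1) in \<open>force simp: less_le\<close>)
      have quot: "quot_top t e = ennreal (inverse e) * t" if "0 < e" for t e
        using that by (simp add: quot_top_def divide_ennreal_def inverse_ennreal mult.commute)
      have eq: "(\<integral>\<^sup>+\<omega>. quot_top (g \<omega>) (\<delta>h \<omega>) \<partial>M) = (\<integral>\<^sup>+\<omega>. ennreal (inverse (\<delta>h \<omega>)) * g \<omega> \<partial>M)" for g
        by (rule nn_integral_cong_AE) (use pos in eventually_elim, simp add: quot)
      have "AE \<omega> in M. (\<Sum>l\<in>{1..n}. geo_weight \<delta> (\<delta>h \<omega>) k l) \<le> 2 / \<delta> * inverse (\<delta>h \<omega>)"
        using pos AE_space
      proof eventually_elim
        case (elim \<omega>)
        have "2 / \<delta> + 2 / \<delta>h \<omega> = 2 * (\<delta> + \<delta>h \<omega>) / (\<delta> * \<delta>h \<omega>)"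
          using elim \<delta> by (simp add: field_simps)
        \<comment> \<open>Both minima are at most 1/2, so their sum is at most 1.\<close>
        also have "\<dots> \<le> 2 * 1 / (\<delta> * \<delta>h \<omega>)"
          using elim \<delta> \<delta>h(2)[of \<omega>] by (intro divide_right_mono mult_left_mono) auto
        finally have "2 / \<delta> + 2 / \<delta>h \<omega> \<le> 2 / \<delta> * inverse (\<delta>h \<omega>)"
          by (simp add: divide_inverse)
        with sum_geo_weight[of \<delta> "\<delta>h \<omega>" k n] elim k \<delta> \<delta>h(2)[of \<omega>] show ?case by simp
      qed
      then show ?thesis
        unfolding eq using core[of n k inverse] k n pos by simp
    qed
  qed
qed

end
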